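(* Let $1<p<q\le\infty$ with $\frac1p+\frac1q<1$, and define $F_{p,q}:\mathcal{S}(\mathbb{R})\setminus\{0\}\to\mathbb{R}_{>0}$ by \[F_{p,q}(f)=\frac{\|f\|_q\|\hat f\|_q}{\|f\|_p\|\hat f\|_p}.\] Then the image of $F_{p,q}$ is all of $\mathbb{R}_{>0}$.
   Context: $\mathcal{S}(\mathbb{R})$ is the space of Schwartz functions on $\mathbb{R}$; $\|\cdot\|_r$ is the $L^r(\mathbb{R})$ norm with respect to Lebesgue measure; the Fourier transform is $\hat f(\xi)=\int_{\mathbb{R}}f(x)e^{-2\pi i x\xi}\,dx$. *)

theory Defs
  imports "HOL-Analysis.Analysis" "HOL-Probability.Essential_Supremum"
begin

definition nth_deriv :: "nat \<Rightarrow> (real \<Rightarrow> complex) \<Rightarrow> real \<Rightarrow> complex" where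
  "nth_deriv n f = ((\<lambda>g x. vector_derivative g (at x)) ^^ n) f"

definition schwartz :: "(real \<Rightarrow> complex) set" where
  "schwartz = {f. (\<forall>n x. nth_deriv n f differentiable (at x)) \<and>
                 (\<forall>m n. \<exists>C. \<forall>x. \<bar>x\<bar> ^ m * norm (nth_deriv n f x) \<le> C)}"

definition Lp_norm :: "ereal \<Rightarrow> (real \<Rightarrow> complex) \<Rightarrow> real" where
  "Lp_norm r f = (if r = \<infinity> then real_of_ereal (esssup lborel (\<lambda>x. ereal (norm (f x))))
     else (LINT x|lborel. norm (f x) powr real_of_ereal r) powr (1 / real_of_ereal r))"

definition fourier :: "(real \<Rightarrow> complex) \<Rightarrow> real \<Rightarrow> complex" where
  "fourier f \<xi> = (LINT x|lborel. f x * exp (- 2 * pi * \<i> * complex_of_real (x * \<xi>)))"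

definition F_pq :: "ereal \<Rightarrow> ereal \<Rightarrow> (real \<Rightarrow> complex) \<Rightarrow> real" where
  "F_pq p q f = (Lp_norm q f * Lp_norm q (fourier f)) / (Lp_norm p f * Lp_norm p (fourier f))"

end

theory Submission
  imports Defs "HOL-Probability.Sinc_Integral" "HOL-Probability.Distributions" "HOL-Real_Asymp.Real_Asymp"
begin

text \<open>The values of \<open>F\<close> are positive because the Fourier transform is injective on Schwartz functions.
  Let \<open>K\<close> be the value of \<open>F\<close> at a real Gaussian. The chirps \<open>exp (- \<pi> (1 + i b) x\<^sup>2)\<close> give
  \<open>K (1 + b\<^sup>2) powr (- (1/p - 1/q) / 2)\<close>, hence all of \<open>(0, K]\<close>. The functions
  \<open>f\<^sub>s = s exp (- \<pi> s\<^sup>4 x\<^sup>2) + s\<^sup>-\<^sup>1 exp (- \<pi> s\<^sup>-\<^sup>4 x\<^sup>2)\<close> are their own Fourier transforms, and \<open>F f\<^sub>s\<close>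
  is continuous in \<open>s \<ge> 1\<close> and equals \<open>K\<close> at \<open>s = 1\<close>. Comparing the tall summand in \<open>L\<^sup>q\<close> with both
  summands in \<open>L\<^sup>p\<close> shows that \<open>F f\<^sub>s\<close> tends to infinity because \<open>1/q < 1/p\<close> and
  \<open>1/p + 1/q < 1\<close>; the intermediate value theorem gives \<open>[K, \<infinity>)\<close>.\<close>

section \<open>Integration on the real line\<close>

text \<open>In a first-countable space limits can be tested along sequences, so the sequential
  dominated convergence theorem carries over to a continuous parameter. It serves to differentiate
  under the Fourier integral, to pass to the limit in Gaussian averages and to prove continuity in
  \<open>s\<close>.\<close>

lemma integral_dominated_convergence_at_within:
  fixes s :: "'p::first_countable_topology \<Rightarrow> 'a \<Rightarrow> 'b::{banach, second_countable_topology}"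
  assumes "f \<in> borel_measurable M" "\<And>t. t \<in> S - {a} \<Longrightarrow> s t \<in> borel_measurable M" "integrable M w"
    and lim: "\<And>x. ((\<lambda>t. s t x) \<longlongrightarrow> f x) (at a within S)"
    and bound: "\<And>t x. t \<in> S - {a} \<Longrightarrow> norm (s t x) \<le> w x"
  shows "((\<lambda>t. integral\<^sup>L M (s t)) \<longlongrightarrow> integral\<^sup>L M f) (at a within S)"
  unfolding tendsto_at_iff_sequentially comp_def
proof (intro allI impI)
  fix X assume X: "\<forall>i. X i \<in> S - {a}" "X \<longlonglongrightarrow> a"
  show "(\<lambda>n. integral\<^sup>L M (s (X n))) \<longlonglongrightarrow> integral\<^sup>L M f"
  proof (rule integral_dominated_convergence[where w = w])
    show "AE x in M. (\<lambda>n. s (X n) x) \<longlonglongrightarrow> f x"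
      using lim X unfolding tendsto_at_iff_sequentially comp_def by blast
  qed (use assms X in auto)
qed

text \<open>A nonempty open set is not a null set. This turns almost-everywhere information about
  continuous functions into pointwise information.\<close>

lemma AE_lborel_imp_ex_open:
  fixes U :: "real set"
  assumes "AE x in lborel. P x" "open U" "x \<in> U"
  shows "\<exists>y\<in>U. P y"
proof (rule ccontr)
  assume "\<not> ?thesis"
  \<comment> \<open>If \<open>P\<close> fails throughout \<open>U\<close>, almost every point of
    \<open>U\<close> lies in the empty set; a closed set that contains almost all of an open set
    contains all of it.\<close>
  then have "AE y \<in> U in lebesgue. y \<in> {}"
    using AE_completion[OF assms(1)] by (auto elim!: eventually_mono)
  from mem_closed_if_AE_lebesgue_open[OF assms(2) closed_empty this assms(3)] show False by simp
qed

lemma integrable_inverse_1_plus_square_lborel: "integrable lborel (\<lambda>x::real. inverse (1 + x\<^sup>2))"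
  using integrable_inverse_1_plus_square by (simp add: set_integrable_def einterval_def)

lemma quadratic_decay_bounded:
  fixes f :: "real \<Rightarrow> 'a::real_normed_vector"
  assumes f: "\<And>x. norm (f x) \<le> C * inverse (1 + x\<^sup>2)"
  shows "norm (f x) \<le> C"
proof -
  have "0 \<le> C"
    using order_trans[OF norm_ge_zero f[of 0]] by simp
  have "inverse (1 + x\<^sup>2) \<le> 1"
    by (intro inverse_le_1_iff[THEN iffD2]) auto
  then show ?thesis
    using f[of x] mult_left_mono[OF _ \<open>0 \<le> C\<close>, of "inverse (1 + x\<^sup>2)" 1] by linarith
qed

text \<open>The bound \<open>C * inverse (1 + x\<^sup>2)\<close> is the common decay condition of
  the development: Schwartz functions and their transforms both satisfy it.\<close>

lemma integrable_quadratic_decay: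
  fixes f :: "real \<Rightarrow> 'a::{banach, second_countable_topology}"
  assumes "continuous_on UNIV f" and "\<And>x. norm (f x) \<le> C * inverse (1 + x\<^sup>2)"
  shows "integrable lborel f"
proof (rule Bochner_Integration.integrable_bound)
  show "integrable lborel (\<lambda>x. C * inverse (1 + x\<^sup>2))"
    by (intro integrable_mult_right integrable_inverse_1_plus_square_lborel)
  show "f \<in> borel_measurable lborel"
    using borel_measurable_continuous_onI[OF assms(1)] by simp
  show "AE x in lborel. norm (f x) \<le> norm (C * inverse (1 + x\<^sup>2))"
    using assms(2) by (intro AE_I2) (metis abs_ge_self order_trans real_norm_def)
qed

lemma integral_pos_continuous:
  fixes f :: "real \<Rightarrow> real"
  assumes f: "integrable lborel f" "continuous_on UNIV f" and nonneg: "\<And>x. 0 \<le> f x" and "f x0 \<noteq> 0"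
  shows "0 < integral\<^sup>L lborel f"
proof -
  have "integral\<^sup>L lborel f \<noteq> 0"
  proof
    assume "integral\<^sup>L lborel f = 0"
    then have "AE x in lborel. f x = 0"
      using integral_nonneg_eq_0_iff_AE[OF f(1)] nonneg by auto
    moreover have "open {x. f x \<noteq> 0}"
      using f(2) by (intro open_Collect_neq continuous_on_const)
    ultimately show False
      using AE_lborel_imp_ex_open[where x = x0] \<open>f x0 \<noteq> 0\<close> by fastforce
  qed
  then show ?thesis
    using nonneg by (simp add: order_less_le)
qed

text \<open>Fundamental theorem of calculus on the whole line with vanishing boundary values;
  applied to a product it is integration by parts.\<close>

lemma integral_derivative_eq_0:
  fixes f :: "real \<Rightarrow> 'a::euclidean_space"
  assumes "\<And>x. (f has_vector_derivative f' x) (at x)" "continuous_on UNIV f'" "integrable lborel f'"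
    and "(f \<longlongrightarrow> 0) at_top" "(f \<longlongrightarrow> 0) at_bot"
  shows "integral\<^sup>L lborel f' = 0"
proof -
  have "(LBINT x=-\<infinity>..\<infinity>. f' x) = 0 - 0"
  proof (rule interval_integral_FTC_integrable)
    show "((f \<circ> real_of_ereal) \<longlongrightarrow> 0) (at_right (-\<infinity>))" "((f \<circ> real_of_ereal) \<longlongrightarrow> 0) (at_left \<infinity>)"
      using assms(4,5) by (simp_all add: ereal_tendsto_simps)
    show "set_integrable lborel (einterval (-\<infinity>) \<infinity>) f'"
      using assms(3) by (simp add: set_integrable_def einterval_def)
  qed (use assms in \<open>auto simp: continuous_on_eq_continuous_at\<close>)
  then show ?thesis
    by (simp add: interval_lebesgue_integral_def set_lebesgue_integral_def einterval_def)
qed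

section \<open>The norms\<close>

lemma Lp_norm_finite: "Lp_norm (ereal r) f = (LINT x|lborel. norm (f x) powr r) powr (1 / r)"
  by (simp add: Lp_norm_def)

lemma Lp_norm_infinity: "Lp_norm \<infinity> f = real_of_ereal (esssup lborel (\<lambda>x. ereal (norm (f x))))"
  by (simp add: Lp_norm_def)

text \<open>Since \<open>inverse (1 + x\<^sup>2)\<close> is at most 1, raising it to a power
  \<open>r \<ge> 1\<close> only makes it smaller, so the same dominating function works up to the
  constant.\<close>

lemma integrable_powr_quadratic_decay:
  fixes f :: "real \<Rightarrow> 'a::real_normed_vector"
  assumes f: "continuous_on UNIV f" "\<And>x. norm (f x) \<le> C * inverse (1 + x\<^sup>2)" and "1 \<le> r"
  shows "integrable lborel (\<lambda>x. norm (f x) powr r)"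
proof (rule integrable_quadratic_decay)
  show "continuous_on UNIV (\<lambda>x. norm (f x) powr r)"
    using f(1) \<open>1 \<le> r\<close> by (intro continuous_on_powr' continuous_intros) auto
  have "0 \<le> C"
    using order_trans[OF norm_ge_zero f(2)[of 0]] by simp
  show "norm (norm (f x) powr r) \<le> C powr r * inverse (1 + x\<^sup>2)" for x
  proof -
    have "0 < 1 + x\<^sup>2"
      by (smt (verit) zero_le_power2)
    have "norm (f x) powr r \<le> (C * inverse (1 + x\<^sup>2)) powr r"
      using f(2) \<open>1 \<le> r\<close> by (intro powr_mono2) auto
    also have "\<dots> = C powr r * inverse (1 + x\<^sup>2) powr r"
      using \<open>0 \<le> C\<close> by (intro powr_mult)
    also have "\<dots> \<le> C powr r * inverse (1 + x\<^sup>2) powr 1"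
      using \<open>1 \<le> r\<close> \<open>0 < 1 + x\<^sup>2\<close>
      by (intro mult_left_mono powr_mono') (auto simp: field_simps)
    finally show ?thesis
      using \<open>0 < 1 + x\<^sup>2\<close> by simp
  qed
qed

text \<open>Were the bound false, some level \<open>c\<close> strictly in between would be exceeded
  on a nonempty open set, hence also at a point where the essential bound holds.\<close>

lemma esssup_norm_ge_continuous:
  fixes f :: "real \<Rightarrow> complex"
  assumes f: "continuous_on UNIV f"
  shows "ereal (norm (f x0)) \<le> esssup lborel (\<lambda>x. ereal (norm (f x)))" (is "_ \<le> ?s")
proof (rule ccontr)
  assume "\<not> ?thesis"
  then obtain c where c: "?s < ereal c" "ereal c < ereal (norm (f x0))"
    using ereal_dense2[of ?s "norm (f x0)"] by (auto simp: not_le)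
  have "open {x. c < norm (f x)}"
    using f by (intro open_Collect_less continuous_intros)
  then obtain y where y: "c < norm (f y)" "ereal (norm (f y)) \<le> ?s"
    using AE_lborel_imp_ex_open[OF esssup_AE[of "\<lambda>x. ereal (norm (f x))" lborel], of "{x. c < norm (f x)}" x0] c
    by auto
  from y(2) c(1) have "ereal (norm (f y)) < ereal c"
    by (rule order.strict_trans1)
  with y(1) show False by simp
qed

lemma esssup_norm_le_continuous:
  fixes f :: "real \<Rightarrow> complex"
  assumes f: "continuous_on UNIV f" and "\<And>x. norm (f x) \<le> c"
  shows "esssup lborel (\<lambda>x. ereal (norm (f x))) \<le> ereal c"
proof (rule esssup_I)
  show "(\<lambda>x. ereal (norm (f x))) \<in> borel_measurable lborel"
    using borel_measurable_continuous_onI[OF f] by measurable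
qed (use assms(2) in auto)

lemma Lp_norm_infinity_attained:
  assumes "continuous_on UNIV f" and "\<And>x. norm (f x) \<le> norm (f x0)"
  shows "Lp_norm \<infinity> f = norm (f x0)"
  using antisym[OF esssup_norm_le_continuous[OF assms] esssup_norm_ge_continuous[OF assms(1), of x0]]
  by (simp add: Lp_norm_infinity)

lemma Lp_norm_pos:
  assumes f: "continuous_on UNIV f" "\<And>x. norm (f x) \<le> C * inverse (1 + x\<^sup>2)"
    and "f x0 \<noteq> 0" "1 \<le> r"
  shows "0 < Lp_norm r f"
proof (cases r)
  case (real t)
  with \<open>1 \<le> r\<close> have "1 \<le> t" by simp
  have "0 < (LINT x|lborel. norm (f x) powr t)"
  proof (rule integral_pos_continuous)
    show "continuous_on UNIV (\<lambda>x. norm (f x) powr t)"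
      using f(1) \<open>1 \<le> t\<close> by (intro continuous_on_powr' continuous_intros) auto
    show "norm (f x0) powr t \<noteq> 0"
      using \<open>f x0 \<noteq> 0\<close> by simp
  qed (use f \<open>1 \<le> t\<close> in \<open>auto intro: integrable_powr_quadratic_decay\<close>)
  then show ?thesis
    by (simp add: real Lp_norm_finite)
next
  case PInf
  \<comment> \<open>The upper bound matters as much as the lower one: \<open>real_of_ereal\<close>
    sends \<infinity> to 0, so the essential supremum must be known to be finite.\<close>
  from esssup_norm_le_continuous[OF f(1) quadratic_decay_bounded[OF f(2)]] esssup_norm_ge_continuous[OF f(1), of x0]
  have "0 < real_of_ereal (esssup lborel (\<lambda>x. ereal (norm (f x))))" (is "0 < real_of_ereal ?s")
    using \<open>f x0 \<noteq> 0\<close> by (cases ?s) (auto intro: less_le_trans[of 0 "norm (f x0)"])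
  then show ?thesis
    by (simp add: PInf Lp_norm_infinity)
qed (use \<open>1 \<le> r\<close> in auto)

section \<open>Schwartz functions\<close>

lemma nth_deriv_0 [simp]: "nth_deriv 0 f = f"
  by (simp add: nth_deriv_def)

lemma nth_deriv_Suc: "nth_deriv (Suc n) f = (\<lambda>x. vector_derivative (nth_deriv n f) (at x))"
  by (simp add: nth_deriv_def)

text \<open>Moving the extra derivative to the inside exhibits the derivatives of \<open>f'\<close>
  as derivatives of \<open>f\<close>, which makes Schwartz space closed under
  differentiation.\<close>

lemma nth_deriv_Suc_inner: "nth_deriv (Suc n) f = nth_deriv n (\<lambda>x. vector_derivative f (at x))"
  by (simp only: nth_deriv_def funpow_Suc_right o_apply)

lemma schwartz_vector_derivative:
  assumes "f \<in> schwartz"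
  shows "(\<lambda>x. vector_derivative f (at x)) \<in> schwartz"
  using assms unfolding schwartz_def mem_Collect_eq nth_deriv_Suc_inner[symmetric] by blast

lemma schwartz_has_vector_derivative:
  assumes "f \<in> schwartz"
  shows "(f has_vector_derivative vector_derivative f (at x)) (at x)"
proof -
  have "nth_deriv 0 f differentiable (at x)"
    using assms unfolding schwartz_def by blast
  then show ?thesis
    by (simp add: vector_derivative_works)
qed

lemma schwartz_continuous: "f \<in> schwartz \<Longrightarrow> continuous_on UNIV f"
  by (meson continuous_at_imp_continuous_on has_vector_derivative_continuous schwartz_has_vector_derivative)

text \<open>The seminorm bounds for the exponents \<open>m\<close> and \<open>m + 2\<close> add up
  to a bound for \<open>\<bar>x\<bar> ^ m * norm (f x) * (1 + x\<^sup>2)\<close>.\<close>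

lemma schwartz_decay:
  assumes "f \<in> schwartz"
  obtains C where "\<And>x. \<bar>x\<bar> ^ m * norm (f x) \<le> C * inverse (1 + x\<^sup>2)"
proof -
  have "\<exists>C. \<forall>x. \<bar>x\<bar> ^ k * norm (nth_deriv 0 f x) \<le> C" for k
    using assms unfolding schwartz_def by blast
  then obtain C where C: "\<And>k x. \<bar>x\<bar> ^ k * norm (f x) \<le> C k"
    by simp metis
  have "\<bar>x\<bar> ^ m * norm (f x) \<le> (C m + C (m + 2)) * inverse (1 + x\<^sup>2)" for x
  proof -
    have "\<bar>x\<bar> ^ m * norm (f x) * (1 + x\<^sup>2) = \<bar>x\<bar> ^ m * norm (f x) + \<bar>x\<bar> ^ (m + 2) * norm (f x)"
      by (simp add: algebra_simps power_add power2_eq_square)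
    also have "\<dots> \<le> C m + C (m + 2)"
      by (intro add_mono C)
    finally show ?thesis
      by (simp add: field_simps add_pos_nonneg)
  qed
  then show thesis by (rule that)
qed

lemma schwartz_integrable_moment:
  assumes "f \<in> schwartz"
  shows "integrable lborel (\<lambda>x. of_real x ^ m * f x)"
proof -
  obtain C where "\<And>x. \<bar>x\<bar> ^ m * norm (f x) \<le> C * inverse (1 + x\<^sup>2)"
    using schwartz_decay[OF assms] by blast
  then show ?thesis
    using schwartz_continuous[OF assms]
    by (intro integrable_quadratic_decay[where C = C])
       (auto intro!: continuous_intros simp: norm_mult norm_power)
qed

lemma schwartz_integrable: "f \<in> schwartz \<Longrightarrow> integrable lborel f"
  using schwartz_integrable_moment[of f 0] by simp

lemma schwartz_tendsto_0:
  assumes "f \<in> schwartz"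
  shows "(f \<longlongrightarrow> 0) at_top" "(f \<longlongrightarrow> 0) at_bot"
proof -
  obtain C where C: "\<And>x. \<bar>x\<bar> ^ 0 * norm (f x) \<le> C * inverse (1 + x\<^sup>2)"
    using schwartz_decay[OF assms] by blast
  have "((\<lambda>x. C * inverse (1 + x\<^sup>2)) \<longlongrightarrow> 0) at_top" "((\<lambda>x. C * inverse (1 + x\<^sup>2)) \<longlongrightarrow> 0) at_bot"
    by real_asymp+
  then show "(f \<longlongrightarrow> 0) at_top" "(f \<longlongrightarrow> 0) at_bot"
    using C by (auto intro: Lim_null_comparison[rotated])
qed

lemma nth_deriv_add:
  assumes "f \<in> schwartz" "g \<in> schwartz"
  shows "nth_deriv n (\<lambda>x. f x + g x) = (\<lambda>x. nth_deriv n f x + nth_deriv n g x)"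
proof (induction n)
  case (Suc n)
  have "nth_deriv n f differentiable at x" "nth_deriv n g differentiable at x" for x
    using assms unfolding schwartz_def by blast+
  then show ?case
    by (simp add: nth_deriv_Suc Suc vector_derivative_add_at)
qed simp

lemma schwartz_add:
  assumes "f \<in> schwartz" "g \<in> schwartz"
  shows "(\<lambda>x. f x + g x) \<in> schwartz"
proof -
  have "\<exists>C. \<forall>x. \<bar>x\<bar> ^ m * norm (nth_deriv n f x + nth_deriv n g x) \<le> C" for m n
  proof -
    obtain C D where "\<And>x. \<bar>x\<bar> ^ m * norm (nth_deriv n f x) \<le> C" "\<And>x. \<bar>x\<bar> ^ m * norm (nth_deriv n g x) \<le> D"
      using assms unfolding schwartz_def by blast
    then have "\<bar>x\<bar> ^ m * norm (nth_deriv n f x + nth_deriv n g x) \<le> C + D" for x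
      by (smt (verit, best) distrib_left mult_left_mono norm_triangle_ineq zero_le_power abs_ge_zero)
    then show ?thesis by blast
  qed
  then show ?thesis
    using assms unfolding schwartz_def mem_Collect_eq nth_deriv_add[OF assms]
    by (auto intro!: differentiable_add)
qed

section \<open>The Fourier transform\<close>

lemma norm_fourier_kernel [simp]: "norm (exp (- 2 * pi * \<i> * complex_of_real t)) = 1"
  by (simp add: norm_exp_eq_Re)

lemma fourier_kernel_measurable [measurable]:
  "(\<lambda>x. exp (- 2 * pi * \<i> * complex_of_real (x * \<xi>))) \<in> borel_measurable borel"
  by (intro borel_measurable_continuous_onI continuous_intros)

lemma integrable_fourier_integrand:
  assumes "integrable lborel f"
  shows "integrable lborel (\<lambda>x. f x * exp (- 2 * pi * \<i> * complex_of_real (x * \<xi>)))"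
  by (rule Bochner_Integration.integrable_bound[OF assms])
     (use borel_measurable_integrable[OF assms] in \<open>simp_all add: norm_mult del: of_real_mult\<close>)

lemma norm_fourier_le: "norm (fourier f \<xi>) \<le> (LINT x|lborel. norm (f x))"
proof -
  have "norm (fourier f \<xi>) \<le> (LINT x|lborel. norm (f x * exp (- 2 * pi * \<i> * complex_of_real (x * \<xi>))))"
    unfolding fourier_def by (rule integral_norm_bound)
  then show ?thesis
    by (simp add: norm_mult del: of_real_mult)
qed

text \<open>Difference quotients are the form to which dominated convergence applies.\<close>

lemma has_vector_derivative_iff_quotient:
  "(f has_vector_derivative D) (at x) \<longleftrightarrow> ((\<lambda>h. (f (x + h) - f x) /\<^sub>R h) \<longlongrightarrow> D) (at 0)"
proof -
  have "norm (f (x + h) - f x - h *\<^sub>R D) / norm h = norm ((f (x + h) - f x) /\<^sub>R h - D)" if "h \<noteq> 0" for h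
  proof -
    have "f (x + h) - f x - h *\<^sub>R D = h *\<^sub>R ((f (x + h) - f x) /\<^sub>R h - D)"
      using that by (simp add: scaleR_diff_right)
    then show ?thesis
      using that by simp
  qed
  then have "(\<lambda>h. norm (f (x + h) - f x - h *\<^sub>R D) / norm h) \<midarrow>0\<rightarrow> 0 \<longleftrightarrow>
      (\<lambda>h. norm ((f (x + h) - f x) /\<^sub>R h - D)) \<midarrow>0\<rightarrow> 0"
    by (intro LIM_cong) auto
  then show ?thesis
    by (simp add: has_vector_derivative_def has_derivative_at bounded_linear_scaleR_left
        tendsto_norm_zero_iff LIM_zero_iff)
qed

text \<open>Differentiation under the integral sign. The kernel \<open>e\<close> is Lipschitz with
  constant \<open>2 * pi\<close>, so the difference quotients \<open>D h x\<close> are dominated by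
  \<open>2 * pi * norm (of_real x * f x)\<close> uniformly in \<open>h\<close>.\<close>

lemma fourier_has_vector_derivative:
  assumes f: "integrable lborel f" and xf: "integrable lborel (\<lambda>x. of_real x * f x)"
  shows "(fourier f has_vector_derivative - 2 * pi * \<i> * fourier (\<lambda>x. of_real x * f x) \<xi>) (at \<xi>)"
proof -
  define e where "e t = exp (- 2 * pi * \<i> * complex_of_real t)" for t
  have e_deriv: "(e has_vector_derivative - 2 * pi * \<i> * e t) (at t)" for t
    unfolding e_def by (auto intro!: derivative_eq_intros has_vector_derivative_real_field)
  have e_lipschitz: "norm (e t - e s) \<le> 2 * pi * \<bar>t - s\<bar>" for s t
  proof -
    have "norm (e t - e s) \<le> (2 * pi) * norm (t - s)"
    proof (rule differentiable_bound[OF convex_UNIV])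
      show "(e has_derivative (\<lambda>h. h *\<^sub>R (- 2 * pi * \<i> * e t))) (at t)" for t
        using e_deriv[of t] by (simp add: has_vector_derivative_def)
      show "onorm (\<lambda>h. h *\<^sub>R (- 2 * pi * \<i> * e t)) \<le> 2 * pi" for t
        by (intro onorm_le) (simp add: e_def norm_mult)
    qed auto
    then show ?thesis by simp
  qed
  have [measurable]: "f \<in> borel_measurable lborel"
    using f by (rule borel_measurable_integrable)
  have [measurable]: "(\<lambda>x. e (x * t)) \<in> borel_measurable borel" for t
    unfolding e_def by measurable
  have int: "integrable lborel (\<lambda>x. f x * e (x * t))" for t
    unfolding e_def using f by (rule integrable_fourier_integrand)
  define D where "D h x = (f x * e (x * (\<xi> + h)) - f x * e (x * \<xi>)) /\<^sub>R h" for h x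
  have "((\<lambda>h. LINT x|lborel. D h x) \<longlongrightarrow> (LINT x|lborel. - 2 * pi * \<i> * (of_real x * f x * e (x * \<xi>)))) (at 0)"
  proof (rule integral_dominated_convergence_at_within[where w = "\<lambda>x. 2 * pi * norm (of_real x * f x)"])
    show "integrable lborel (\<lambda>x. 2 * pi * norm (of_real x * f x))"
      using xf by (intro integrable_mult_right integrable_norm)
    show "((\<lambda>h. D h x) \<longlongrightarrow> - 2 * pi * \<i> * (of_real x * f x * e (x * \<xi>))) (at 0)" for x
    proof -
      have "((\<lambda>t. f x * e (x * t)) has_vector_derivative f x * (x *\<^sub>R (- 2 * pi * \<i> * e (x * \<xi>)))) (at \<xi>)"
      proof (rule has_vector_derivative_mult_right)
        have "((\<lambda>t. x * t) has_vector_derivative x) (at \<xi>)"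
          by (auto intro!: derivative_eq_intros)
        from vector_diff_chain_at[OF this e_deriv]
        show "((\<lambda>t. e (x * t)) has_vector_derivative x *\<^sub>R (- 2 * pi * \<i> * e (x * \<xi>))) (at \<xi>)"
          by (simp add: o_def)
      qed
      then show ?thesis
        unfolding D_def by (simp add: has_vector_derivative_iff_quotient scaleR_conv_of_real algebra_simps)
    qed
    show "norm (D h x) \<le> 2 * pi * norm (of_real x * f x)" if "h \<in> UNIV - {0}" for h x
    proof -
      have "norm (D h x) = norm (f x) * norm (e (x * (\<xi> + h)) - e (x * \<xi>)) / \<bar>h\<bar>"
        by (simp add: D_def norm_mult right_diff_distrib[symmetric] divide_inverse)
      also have "\<dots> \<le> norm (f x) * (2 * pi * \<bar>x * h\<bar>) / \<bar>h\<bar>"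
        using e_lipschitz[of "x * (\<xi> + h)" "x * \<xi>"]
        by (intro divide_right_mono mult_left_mono) (auto simp: algebra_simps)
      finally show ?thesis
        using that by (simp add: abs_mult norm_mult mult_ac)
    qed
  qed (auto simp: D_def)
  moreover have "(LINT x|lborel. D h x) = (fourier f (\<xi> + h) - fourier f \<xi>) /\<^sub>R h" for h
    unfolding D_def fourier_def e_def[symmetric]
    by (subst integral_scaleR_right, subst Bochner_Integration.integral_diff) (auto intro: int)
  moreover have "(LINT x|lborel. - 2 * pi * \<i> * (of_real x * f x * e (x * \<xi>)))
      = - 2 * pi * \<i> * fourier (\<lambda>x. of_real x * f x) \<xi>"
    unfolding fourier_def e_def[symmetric] by (rule integral_mult_right_zero)
  ultimately have "((\<lambda>h. (fourier f (\<xi> + h) - fourier f \<xi>) /\<^sub>R h) \<longlongrightarrow>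
      - 2 * pi * \<i> * fourier (\<lambda>x. of_real x * f x) \<xi>) (at 0)"
    by simp
  then show ?thesis
    by (simp only: has_vector_derivative_iff_quotient)
qed

lemma fourier_cmult: "fourier (\<lambda>x. c * f x) \<xi> = c * fourier f \<xi>"
  by (simp add: fourier_def mult.assoc)

text \<open>Integration by parts: the derivative of \<open>f x * e x\<close> integrates to 0,
  because \<open>f\<close> vanishes at both ends and \<open>e\<close> has modulus 1.\<close>

lemma fourier_vector_derivative:
  assumes f: "f \<in> schwartz"
  shows "fourier (\<lambda>x. vector_derivative f (at x)) \<xi> = 2 * pi * \<i> * \<xi> * fourier f \<xi>"
proof -
  define f' where "f' x = vector_derivative f (at x)" for x
  define e where "e x = exp (- 2 * pi * \<i> * complex_of_real (x * \<xi>))" for x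
  have f': "f' \<in> schwartz"
    unfolding f'_def by (rule schwartz_vector_derivative[OF f])
  have e_deriv: "(e has_vector_derivative - 2 * pi * \<i> * \<xi> * e x) (at x)" for x
    unfolding e_def by (auto intro!: derivative_eq_intros has_vector_derivative_real_field)
  have norm_e: "norm (e x) = 1" for x
    unfolding e_def by (rule norm_fourier_kernel)
  have int: "integrable lborel (\<lambda>x. g x * e x)" if "g \<in> schwartz" for g
    unfolding e_def using that by (intro integrable_fourier_integrand schwartz_integrable)
  have "(LINT x|lborel. f' x * e x + - 2 * pi * \<i> * \<xi> * (f x * e x)) = 0"
  proof (rule integral_derivative_eq_0)
    show "((\<lambda>x. f x * e x) has_vector_derivative f' x * e x + - 2 * pi * \<i> * \<xi> * (f x * e x)) (at x)" for x
      using has_vector_derivative_mult[OF schwartz_has_vector_derivative[OF f] e_deriv]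
      by (simp add: f'_def algebra_simps)
    show "continuous_on UNIV (\<lambda>x. f' x * e x + - 2 * pi * \<i> * \<xi> * (f x * e x))"
      unfolding e_def by (intro continuous_intros schwartz_continuous f f')
    show "integrable lborel (\<lambda>x. f' x * e x + - 2 * pi * \<i> * \<xi> * (f x * e x))"
      by (intro Bochner_Integration.integrable_add integrable_mult_right int f f')
    show "((\<lambda>x. f x * e x) \<longlongrightarrow> 0) at_top" "((\<lambda>x. f x * e x) \<longlongrightarrow> 0) at_bot"
      using schwartz_tendsto_0[OF f, THEN tendsto_norm_zero]
      by (auto intro!: tendsto_norm_zero_cancel[of "\<lambda>x. f x * e x"] simp: norm_mult norm_e)
  qed
  also have "(LINT x|lborel. f' x * e x + - 2 * pi * \<i> * \<xi> * (f x * e x)) =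
      fourier f' \<xi> + - 2 * pi * \<i> * \<xi> * fourier f \<xi>"
    unfolding fourier_def e_def[symmetric]
    by (subst Bochner_Integration.integral_add) (auto intro!: int f f' integrable_mult_right)
  finally show ?thesis
    by (simp add: f'_def[abs_def])
qed

lemma fourier_continuous:
  assumes "f \<in> schwartz"
  shows "continuous_on UNIV (fourier f)"
proof (intro continuous_at_imp_continuous_on ballI)
  have "integrable lborel (\<lambda>x. of_real x * f x)"
    using schwartz_integrable_moment[OF assms, of 1] by simp
  from fourier_has_vector_derivative[OF schwartz_integrable[OF assms] this]
  show "isCont (fourier f) \<xi>" for \<xi>
    by (rule has_vector_derivative_continuous)
qed

text \<open>The transform of the second derivative is
  \<open>(2 * pi * \<i> * \<xi>)\<^sup>2 * fourier f \<xi>\<close> and is bounded by an L1 norm;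
  adding the L1 bound for \<open>f\<close> itself yields the factor
  \<open>1 + \<xi>\<^sup>2\<close>.\<close>

lemma fourier_decay:
  assumes f: "f \<in> schwartz"
  obtains C where "\<And>\<xi>. norm (fourier f \<xi>) \<le> C * inverse (1 + \<xi>\<^sup>2)"
proof -
  define f2 where "f2 = (\<lambda>x. vector_derivative (\<lambda>x. vector_derivative f (at x)) (at x))"
  define I where "I g = (LINT x|lborel. norm (g x))" for g :: "real \<Rightarrow> complex"
  have f2: "fourier f2 \<xi> = (2 * pi * \<i> * \<xi>)\<^sup>2 * fourier f \<xi>" for \<xi>
    unfolding f2_def using f
    by (simp add: fourier_vector_derivative schwartz_vector_derivative power2_eq_square)
  have "norm (fourier f \<xi>) \<le> (I f + I f2) * inverse (1 + \<xi>\<^sup>2)" for \<xi>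
  proof -
    have "1 * (\<xi>\<^sup>2 * norm (fourier f \<xi>)) \<le> (2 * pi)\<^sup>2 * (\<xi>\<^sup>2 * norm (fourier f \<xi>))"
      using pi_ge_two by (intro mult_right_mono one_le_power) auto
    also have "\<dots> = norm (fourier f2 \<xi>)"
      by (simp add: f2 norm_mult norm_power power_mult_distrib)
    also have "\<dots> \<le> I f2"
      unfolding I_def by (rule norm_fourier_le)
    finally have "norm (fourier f \<xi>) * (1 + \<xi>\<^sup>2) \<le> I f + I f2"
      using norm_fourier_le[of f \<xi>] by (simp add: I_def algebra_simps)
    then show ?thesis
      by (simp add: field_simps add_pos_nonneg)
  qed
  then show thesis by (rule that)
qed

section \<open>Gaussians\<close>

lemma has_bochner_integral_gaussian:
  assumes "0 < a"
  shows "has_bochner_integral lborel (\<lambda>x::real. exp (- pi * a * x\<^sup>2)) (a powr (-1/2))"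
proof -
  \<comment> \<open>With this standard deviation the normal density is a constant multiple of the
    required Gaussian, so its total mass 1 gives the integral.\<close>
  define \<sigma> where "\<sigma> = 1 / sqrt (2 * pi * a)"
  have \<sigma>: "0 < \<sigma>" "2 * \<sigma>\<^sup>2 = 1 / (pi * a)"
    using assms by (simp_all add: \<sigma>_def power_divide)
  have "has_bochner_integral lborel (normal_density 0 \<sigma>) 1"
    using \<sigma>(1) by (simp add: has_bochner_integral_iff)
  then have "has_bochner_integral lborel (\<lambda>x. sqrt (1 / a) * normal_density 0 \<sigma> x) (sqrt (1 / a) * 1)"
    by (rule has_bochner_integral_mult_right)
  moreover have "sqrt (1 / a) * normal_density 0 \<sigma> x = exp (- pi * a * x\<^sup>2)" for x
  proof -
    have "normal_density 0 \<sigma> x = 1 / sqrt (pi * (2 * \<sigma>\<^sup>2)) * exp (- x\<^sup>2 / (2 * \<sigma>\<^sup>2))"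
      by (simp add: normal_density_def mult_ac)
    also have "\<dots> = sqrt a * exp (- pi * a * x\<^sup>2)"
      unfolding \<sigma>(2) using assms by (simp add: real_sqrt_divide mult_ac)
    finally show ?thesis
      using assms by (simp add: real_sqrt_divide)
  qed
  moreover have "sqrt (1 / a) = a powr (-1/2)"
    using assms by (simp add: powr_minus powr_half_sqrt real_sqrt_divide field_simps)
  ultimately show ?thesis by simp
qed

lemma integral_gaussian: "0 < a \<Longrightarrow> (LINT x|lborel. exp (- pi * a * x\<^sup>2)) = a powr (-1/2)"
  using has_bochner_integral_gaussian by (simp add: has_bochner_integral_iff)

text \<open>A complex parameter treats real Gaussians and chirps together: \<open>Re z\<close>
  determines the modulus, and \<open>Im z\<close> adds only a quadratic phase.\<close>

definition gaussian :: "complex \<Rightarrow> real \<Rightarrow> complex" where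
  "gaussian z x = exp (- complex_of_real pi * z * of_real (x\<^sup>2))"

lemma norm_gaussian: "norm (gaussian z x) = exp (- pi * Re z * x\<^sup>2)"
  by (simp add: gaussian_def norm_exp_eq_Re del: of_real_power)

lemma gaussian_nonzero [simp]: "gaussian z x \<noteq> 0"
  by (simp add: gaussian_def)

lemma gaussian_at_0 [simp]: "gaussian z 0 = 1"
  by (simp add: gaussian_def)

lemma gaussian_continuous [continuous_intros]: "continuous_on S (gaussian z)"
  unfolding gaussian_def by (intro continuous_intros)

lemma gaussian_of_real: "gaussian (of_real a) x = of_real (exp (- pi * a * x\<^sup>2))"
  by (simp add: gaussian_def exp_of_real[symmetric])

text \<open>Polynomial multiples of a fixed Gaussian are closed under differentiation, so bounding
  this one class bounds all derivatives of a Gaussian.\<close>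

lemma poly_gaussian_has_vector_derivative:
  "((\<lambda>x. poly P (of_real x) * gaussian z x) has_vector_derivative
     poly (pderiv P - [:0, 2 * of_real pi * z:] * P) (of_real x) * gaussian z x) (at x)"
proof -
  have "((\<lambda>w. poly P w * exp (- of_real pi * z * w\<^sup>2)) has_field_derivative
      poly (pderiv P - [:0, 2 * of_real pi * z:] * P) w * exp (- of_real pi * z * w\<^sup>2)) (at w)" for w
    by (auto intro!: derivative_eq_intros simp: algebra_simps)
  from has_vector_derivative_real_field[OF this] show ?thesis
    by (simp add: gaussian_def)
qed

lemma gaussian_has_vector_derivative:
  "(gaussian z has_vector_derivative - 2 * of_real pi * z * (of_real x * gaussian z x)) (at x)"
  using poly_gaussian_has_vector_derivative[of 1 z x] by (simp add: mult_ac)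

text \<open>Splitting a polynomial into its constant term and \<open>x\<close> times the rest raises
  the exponent by one, which is why \<open>m\<close> varies in the induction. The constant term
  needs only that the Gaussian beats every power.\<close>

lemma poly_gaussian_bounded:
  assumes "0 < Re z"
  shows "\<exists>C. \<forall>x. \<bar>x\<bar> ^ m * norm (poly P (of_real x) * gaussian z x) \<le> C"
proof (induction P arbitrary: m)
  case 0
  then show ?case by auto
next
  case (pCons a P)
  obtain C where C: "\<And>x. \<bar>x\<bar> ^ Suc m * norm (poly P (of_real x) * gaussian z x) \<le> C"
    using pCons.IH by blast
  have mono: "\<bar>x\<bar> ^ m * exp (- pi * Re z * x\<^sup>2) \<le> 1 + fact m / (pi * Re z) ^ m" for x :: real
  proof -
    define t where "t = pi * Re z * x\<^sup>2"
    have "0 \<le> t" using assms by (simp add: t_def)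
    have "x\<^sup>2 ^ m * exp (- t) \<le> fact m / (pi * Re z) ^ m"
    proof -
      \<comment> \<open>A single term of the exponential series is at most its sum.\<close>
      have "t ^ m / fact m \<le> exp t"
        using sum_le_suminf[OF summable_exp_generic[of t], of "{m}"] \<open>0 \<le> t\<close>
        by (simp add: exp_def divide_inverse mult.commute)
      then show ?thesis
        using assms by (simp add: t_def power_mult_distrib exp_minus field_simps)
    qed
    \<comment> \<open>Passing to an even power produces a power of \<open>t\<close> up to a
      constant; the inequality comes from
      \<open>(\<bar>x\<bar> ^ m - 1)\<^sup>2 \<ge> 0\<close>.\<close>
    moreover have "\<bar>x\<bar> ^ m \<le> 1 + x\<^sup>2 ^ m"
    proof -
      have "x\<^sup>2 ^ m = (\<bar>x\<bar> ^ m)\<^sup>2"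
        by (metis power2_abs power_mult mult.commute)
      moreover have "2 * \<bar>x\<bar> ^ m \<le> (\<bar>x\<bar> ^ m)\<^sup>2 + 1"
        using zero_le_power2[of "\<bar>x\<bar> ^ m - 1"] by (simp add: power2_eq_square algebra_simps)
      moreover have "0 \<le> \<bar>x\<bar> ^ m" by simp
      ultimately show ?thesis by linarith
    qed
    then have "\<bar>x\<bar> ^ m * exp (- t) \<le> (1 + x\<^sup>2 ^ m) * exp (- t)"
      by (intro mult_right_mono) auto
    moreover have "exp (- t) \<le> 1" using \<open>0 \<le> t\<close> by simp
    ultimately have "\<bar>x\<bar> ^ m * exp (- t) \<le> 1 + fact m / (pi * Re z) ^ m"
      unfolding distrib_right by linarith
    then show ?thesis by (simp add: t_def mult.assoc)
  qed
  have "\<bar>x\<bar> ^ m * norm (poly (pCons a P) (of_real x) * gaussian z x) \<le>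
      norm a * (1 + fact m / (pi * Re z) ^ m) + C" for x
  proof -
    have "norm (poly (pCons a P) (of_real x) * gaussian z x) \<le>
        norm (a * gaussian z x) + norm (of_real x * (poly P (of_real x) * gaussian z x))"
      by (rule order_trans[OF _ norm_triangle_ineq]) (simp add: algebra_simps)
    also have "\<dots> = norm a * exp (- pi * Re z * x\<^sup>2) + \<bar>x\<bar> * norm (poly P (of_real x) * gaussian z x)"
      by (simp add: norm_mult norm_gaussian)
    finally have "\<bar>x\<bar> ^ m * norm (poly (pCons a P) (of_real x) * gaussian z x) \<le>
        \<bar>x\<bar> ^ m * (norm a * exp (- pi * Re z * x\<^sup>2) + \<bar>x\<bar> * norm (poly P (of_real x) * gaussian z x))"
      by (intro mult_left_mono) auto
    also have "\<dots> = norm a * (\<bar>x\<bar> ^ m * exp (- pi * Re z * x\<^sup>2)) + \<bar>x\<bar> ^ Suc m * norm (poly P (of_real x) * gaussian z x)"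
      by (simp add: algebra_simps)
    also have "\<dots> \<le> norm a * (1 + fact m / (pi * Re z) ^ m) + C"
      using mono C by (intro add_mono mult_left_mono) auto
    finally show ?thesis .
  qed
  then show ?case by blast
qed

lemma poly_gaussian_schwartz:
  assumes "0 < Re z"
  shows "(\<lambda>x. poly P (of_real x) * gaussian z x) \<in> schwartz"
proof -
  have "\<exists>Q. nth_deriv n (\<lambda>x. poly P (of_real x) * gaussian z x) = (\<lambda>x. poly Q (of_real x) * gaussian z x)" for n
  proof (induction n)
    case (Suc n)
    then obtain Q where "nth_deriv n (\<lambda>x. poly P (of_real x) * gaussian z x) = (\<lambda>x. poly Q (of_real x) * gaussian z x)"
      by blast
    then have "nth_deriv (Suc n) (\<lambda>x. poly P (of_real x) * gaussian z x) =
        (\<lambda>x. poly (pderiv Q - [:0, 2 * of_real pi * z:] * Q) (of_real x) * gaussian z x)"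
      by (simp only: nth_deriv_Suc vector_derivative_at[OF poly_gaussian_has_vector_derivative])
    then show ?case by blast
  qed auto
  then obtain Q where Q: "\<And>n. nth_deriv n (\<lambda>x. poly P (of_real x) * gaussian z x) = (\<lambda>x. poly (Q n) (of_real x) * gaussian z x)"
    by metis
  show ?thesis
    unfolding schwartz_def mem_Collect_eq Q
    using poly_gaussian_bounded[OF assms] poly_gaussian_has_vector_derivative[THEN differentiableI_vector]
    by blast
qed

lemma gaussian_schwartz: "0 < Re z \<Longrightarrow> gaussian z \<in> schwartz"
  using poly_gaussian_schwartz[of z 1] by simp

text \<open>The transform \<open>G\<close> of \<open>g = gaussian z\<close> satisfies \<open>G' = - (2 \<pi> \<xi> / z) G\<close>, which is the
  transform of \<open>g' = - 2 \<pi> z x g\<close>.\<close>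

lemma fourier_gaussian_shape:
  assumes "0 < Re z"
  shows "fourier (gaussian z) \<xi> = fourier (gaussian z) 0 * gaussian (1 / z) \<xi>"
proof -
  define G where "G = fourier (gaussian z)"
  have "z \<noteq> 0" using assms by auto
  have g: "gaussian z \<in> schwartz"
    using assms by (rule gaussian_schwartz)
  have deriv_g: "vector_derivative (gaussian z) (at x) = - 2 * of_real pi * z * (of_real x * gaussian z x)" for x
    by (rule vector_derivative_at[OF gaussian_has_vector_derivative])
  have G_deriv: "(G has_vector_derivative - 2 * of_real pi / z * \<xi> * G \<xi>) (at \<xi>)" for \<xi>
  proof -
    define X where "X = fourier (\<lambda>x. of_real x * gaussian z x) \<xi>"
    have "- 2 * of_real pi * z * X = 2 * pi * \<i> * \<xi> * G \<xi>"
      using fourier_vector_derivative[OF g, of \<xi>] unfolding deriv_g fourier_cmult X_def G_def .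
    then have "(- 2 * of_real pi) * (z * X) = (- 2 * of_real pi) * - (\<i> * \<xi> * G \<xi>)"
      by (simp add: mult_ac)
    then have "z * X = - (\<i> * \<xi> * G \<xi>)"
      by (subst (asm) mult_left_cancel) auto
    then have "X = - (\<i> * \<xi> * G \<xi>) / z"
      using \<open>z \<noteq> 0\<close> by (metis nonzero_mult_div_cancel_left)
    then have "- 2 * pi * \<i> * fourier (\<lambda>x. of_real x * gaussian z x) \<xi> = - 2 * of_real pi / z * \<xi> * G \<xi>"
      unfolding X_def[symmetric] by (simp add: mult_ac)
    with fourier_has_vector_derivative[of "gaussian z" \<xi>] show ?thesis
      using schwartz_integrable[OF g] schwartz_integrable_moment[OF g, of 1] by (simp add: G_def)
  qed
  \<comment> \<open>\<open>gaussian (- 1 / z)\<close> is the integrating factor of the differential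
    equation for \<open>G\<close>. The resulting constant is read off at 0 and left unevaluated, so
    no complex square root of \<open>z\<close> has to be chosen.\<close>
  have "((\<lambda>\<xi>. G \<xi> * gaussian (- 1 / z) \<xi>) has_vector_derivative 0) (at \<xi>)" for \<xi>
    using has_vector_derivative_mult[OF G_deriv gaussian_has_vector_derivative[of "- 1 / z" \<xi>]]
    by (simp add: mult_ac)
  then obtain c where c: "\<And>\<xi>. G \<xi> * gaussian (- 1 / z) \<xi> = c"
    using has_vector_derivative_zero_constant[OF convex_UNIV, of "\<lambda>\<xi>. G \<xi> * gaussian (- 1 / z) \<xi>"] by auto
  then have "G 0 = c"
    by (metis gaussian_at_0 mult.right_neutral)
  have "gaussian (- 1 / z) \<xi> * gaussian (1 / z) \<xi> = 1"
    by (simp add: gaussian_def exp_add[symmetric])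
  then have "G \<xi> = G \<xi> * gaussian (- 1 / z) \<xi> * gaussian (1 / z) \<xi>"
    by (simp add: mult.assoc)
  then show ?thesis
    unfolding c using \<open>G 0 = c\<close> by (simp only: G_def)
qed

lemma fourier_gaussian_of_real:
  assumes "0 < a"
  shows "fourier (gaussian (of_real a)) \<xi> = complex_of_real (a powr (-1/2)) * gaussian (of_real (1 / a)) \<xi>"
proof -
  have "fourier (gaussian (of_real a)) 0 = a powr (-1/2)"
    using integral_gaussian[OF assms] by (simp add: fourier_def gaussian_of_real)
  then show ?thesis
    using fourier_gaussian_shape[of "of_real a" \<xi>] assms by simp
qed

section \<open>Injectivity of the Fourier transform\<close>

text \<open>Both sides are iterated integrals of \<open>h\<close>, whose modulus is the product
  \<open>norm (f x) * norm (g \<xi>)\<close>, so Fubini applies. The formula moves the transform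
  from an unknown \<open>f\<close> to an explicit Gaussian.\<close>

lemma fourier_multiplication_formula:
  assumes f: "integrable lborel f" and g: "integrable lborel g"
  shows "(LINT \<xi>|lborel. fourier f \<xi> * g \<xi>) = (LINT x|lborel. f x * fourier g x)"
proof -
  define e where "e t = exp (- 2 * pi * \<i> * complex_of_real t)" for t
  define h where "h x \<xi> = f x * (g \<xi> * e (\<xi> * x))" for x \<xi>
  have norm_e: "norm (e t) = 1" for t
    unfolding e_def by (rule norm_fourier_kernel)
  have norm_h: "norm (h x \<xi>) = norm (f x) * norm (g \<xi>)" for x \<xi>
    by (simp add: h_def norm_mult norm_e)
  have [measurable]: "f \<in> borel_measurable borel" "g \<in> borel_measurable borel"
    using f g by (auto dest: borel_measurable_integrable)
  have [measurable]: "e \<in> borel_measurable borel"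
    unfolding e_def by (intro borel_measurable_continuous_onI continuous_intros)
  have "integrable (lborel \<Otimes>\<^sub>M lborel) (case_prod h)"
  proof (rule lborel_pair.Fubini_integrable)
    show "case_prod h \<in> borel_measurable (lborel \<Otimes>\<^sub>M lborel)"
      unfolding h_def by measurable
    show "integrable lborel (\<lambda>x. LINT y|lborel. norm (case (x, y) of (x, y) \<Rightarrow> h x y))"
      using f by (simp add: norm_h integrable_norm)
    show "AE x in lborel. integrable lborel (\<lambda>y. case (x, y) of (x, y) \<Rightarrow> h x y)"
      unfolding h_def e_def prod.case using g by (intro AE_I2 integrable_mult_right integrable_fourier_integrand)
  qed
  then have "(LINT \<xi>|lborel. LINT x|lborel. h x \<xi>) = (LINT x|lborel. LINT \<xi>|lborel. h x \<xi>)"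
    by (rule lborel_pair.Fubini_integral)
  moreover have "(LINT x|lborel. h x \<xi>) = fourier f \<xi> * g \<xi>" for \<xi>
  proof -
    have "(LINT x|lborel. h x \<xi>) = (LINT x|lborel. f x * e (x * \<xi>) * g \<xi>)"
      unfolding h_def by (intro Bochner_Integration.integral_cong) (auto simp: mult_ac)
    then show ?thesis
      by (simp add: fourier_def e_def)
  qed
  moreover have "(LINT \<xi>|lborel. h x \<xi>) = f x * fourier g x" for x
    unfolding h_def fourier_def e_def by (rule integral_mult_right_zero)
  ultimately show ?thesis by simp
qed

text \<open>Translation costs only a nonzero phase, so a vanishing transform stays zero after
  recentring \<open>f\<close> at any point.\<close>

lemma fourier_translate:
  "fourier f \<xi> = exp (- 2 * pi * \<i> * complex_of_real (t * \<xi>)) * fourier (\<lambda>x. f (t + x)) \<xi>"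
proof -
  have "fourier f \<xi> = (LINT x|lborel. exp (- 2 * pi * \<i> * complex_of_real (t * \<xi>)) *
      (f (t + x) * exp (- 2 * pi * \<i> * complex_of_real (x * \<xi>))))"
    unfolding fourier_def
    by (subst lborel_integral_real_affine[of 1 _ t]) (simp_all add: exp_add[symmetric] algebra_simps)
  then show ?thesis
    by (simp add: fourier_def)
qed

text \<open>If the transform vanishes, then so do all Gaussian averages of \<open>f\<close> around \<open>x0\<close>, and these
  tend to \<open>f x0\<close>.\<close>

lemma fourier_eq_0_imp_eq_0:
  assumes f: "f \<in> schwartz" and "\<And>\<xi>. fourier f \<xi> = 0"
  shows "f x0 = 0"
proof -
  note f_cont = schwartz_continuous[OF f]
  have shift: "integrable lborel (\<lambda>x. f (x0 + x))"
    using lborel_integrable_real_affine[OF schwartz_integrable[OF f], of 1 x0] by simp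
  have fourier_shift: "fourier (\<lambda>x. f (x0 + x)) \<xi> = 0" for \<xi>
    using fourier_translate[of f \<xi> x0] assms(2) by simp
  \<comment> \<open>The multiplication formula is applied to the Gaussian with parameter
    \<open>c\<^sup>2\<close>, whose transform is a multiple of the one with parameter
    \<open>1 / c\<^sup>2\<close>; the substitution of \<open>c * y\<close> for \<open>x\<close>
    turns the latter into \<open>gaussian 1\<close>.\<close>
  have average: "(LINT y|lborel. f (x0 + c * y) * gaussian 1 y) = 0" if "0 < c" for c
  proof -
    have "gaussian (complex_of_real (c\<^sup>2)) \<in> schwartz"
      using that by (intro gaussian_schwartz) simp
    from fourier_multiplication_formula[OF shift schwartz_integrable[OF this]]
    have "(LINT x|lborel. f (x0 + x) * fourier (gaussian (complex_of_real (c\<^sup>2))) x) = 0"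
      by (simp add: fourier_shift)
    also have "(LINT x|lborel. f (x0 + x) * fourier (gaussian (complex_of_real (c\<^sup>2))) x) =
        (LINT x|lborel. of_real ((c\<^sup>2) powr (-1/2)) * (f (x0 + x) * gaussian (of_real (1 / c\<^sup>2)) x))"
      using that by (subst fourier_gaussian_of_real) (auto simp: mult_ac)
    also have "\<dots> = of_real ((c\<^sup>2) powr (-1/2)) * (LINT x|lborel. f (x0 + x) * gaussian (of_real (1 / c\<^sup>2)) x)"
      by (rule integral_mult_right_zero)
    also have "(LINT x|lborel. f (x0 + x) * gaussian (of_real (1 / c\<^sup>2)) x) =
        \<bar>c\<bar> *\<^sub>R (LINT x|lborel. f (x0 + (0 + c * x)) * gaussian (of_real (1 / c\<^sup>2)) (0 + c * x))"
      using that by (intro lborel_integral_real_affine) simp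
    also have "(\<lambda>x. gaussian (of_real (1 / c\<^sup>2)) (0 + c * x)) = gaussian 1"
      using that by (simp add: gaussian_def fun_eq_iff power_mult_distrib)
    finally show ?thesis
      using that by (auto simp: gaussian_def power_mult_distrib)
  qed
  obtain B where B: "\<And>x. norm (f x) \<le> B"
    using f unfolding schwartz_def mem_Collect_eq by (metis mult_1 nth_deriv_0 power_0)
  \<comment> \<open>After the rescaling \<open>c\<close> occurs only inside the bounded function
    \<open>f\<close>, so one Gaussian dominates for all \<open>c\<close> at once.\<close>
  have "((\<lambda>c. LINT y|lborel. f (x0 + c * y) * gaussian 1 y) \<longlongrightarrow> (LINT y|lborel. f x0 * gaussian 1 y)) (at 0 within {0<..})"
  proof (rule integral_dominated_convergence_at_within[where w = "\<lambda>y. B * norm (gaussian 1 y)"])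
    have cont: "continuous_on UNIV (\<lambda>y. f (x0 + c * y) * gaussian 1 y)" for c
      by (intro continuous_intros continuous_on_compose2[OF f_cont]) auto
    show "(\<lambda>y. f (x0 + c * y) * gaussian 1 y) \<in> borel_measurable lborel" for c
      using borel_measurable_continuous_onI[OF cont] by simp
    show "(\<lambda>y. f x0 * gaussian 1 y) \<in> borel_measurable lborel"
      using borel_measurable_continuous_onI[OF cont[of 0]] by simp
    show "integrable lborel (\<lambda>y. B * norm (gaussian 1 y))"
      by (intro integrable_mult_right integrable_norm schwartz_integrable gaussian_schwartz) simp
    show "((\<lambda>c. f (x0 + c * y) * gaussian 1 y) \<longlongrightarrow> f x0 * gaussian 1 y) (at 0 within {0<..})" for y
    proof -
      have "continuous_on UNIV (\<lambda>c. f (x0 + c * y) * gaussian 1 y)"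
        by (intro continuous_intros continuous_on_compose2[OF f_cont]) auto
      then have "((\<lambda>c. f (x0 + c * y) * gaussian 1 y) \<longlongrightarrow> f (x0 + 0 * y) * gaussian 1 y) (at 0)"
        unfolding continuous_on_def by blast
      from tendsto_within_subset[OF this subset_UNIV, of "{0<..}"] show ?thesis
        by simp
    qed
    show "norm (f (x0 + c * y) * gaussian 1 y) \<le> B * norm (gaussian 1 y)" for c y
      unfolding norm_mult by (intro mult_right_mono B) auto
  qed
  moreover have "((\<lambda>c. LINT y|lborel. f (x0 + c * y) * gaussian 1 y) \<longlongrightarrow> 0) (at 0 within {0<..})"
    by (rule tendsto_eventually) (auto simp: eventually_at_filter average)
  ultimately have "(LINT y|lborel. f x0 * gaussian 1 y) = 0"
    by (rule tendsto_unique[rotated]) (simp add: trivial_limit_at_right_real)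
  moreover have "(LINT y|lborel. gaussian 1 y) = 1"
    using integral_gaussian[of 1] gaussian_of_real[of 1] by simp
  ultimately show ?thesis by simp
qed

text \<open>Injectivity supplies a point where the transform is nonzero; this keeps the denominator
  of \<open>F_pq\<close> away from 0.\<close>

lemma Lp_norm_schwartz_pos:
  assumes "f \<in> schwartz" "f \<noteq> (\<lambda>x. 0)" "1 \<le> r"
  shows "0 < Lp_norm r f" "0 < Lp_norm r (fourier f)"
proof -
  obtain x0 where "f x0 \<noteq> 0"
    using assms(2) by blast
  moreover obtain C where "\<And>x. \<bar>x\<bar> ^ 0 * norm (f x) \<le> C * inverse (1 + x\<^sup>2)"
    using schwartz_decay[OF assms(1)] by blast
  ultimately show "0 < Lp_norm r f"
    using assms by (intro Lp_norm_pos[of f C x0 r] schwartz_continuous) auto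
  obtain \<xi> where "fourier f \<xi> \<noteq> 0"
    using fourier_eq_0_imp_eq_0[OF assms(1)] \<open>f x0 \<noteq> 0\<close> by blast
  moreover obtain D where "\<And>x. norm (fourier f x) \<le> D * inverse (1 + x\<^sup>2)"
    using fourier_decay[OF assms(1)] by blast
  ultimately show "0 < Lp_norm r (fourier f)"
    using assms by (intro Lp_norm_pos[of _ D \<xi> r] fourier_continuous) auto
qed

lemma F_pq_pos:
  assumes "f \<in> schwartz" "f \<noteq> (\<lambda>x. 0)" "1 \<le> p" "1 \<le> q"
  shows "0 < F_pq p q f"
  unfolding F_pq_def using assms by (intro divide_pos_pos mult_pos_pos Lp_norm_schwartz_pos)

section \<open>Norms of Gaussians\<close>

lemma Lp_norm_mono:
  assumes f: "continuous_on UNIV f" and g: "continuous_on UNIV g" "\<And>x. norm (g x) \<le> C * inverse (1 + x\<^sup>2)"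
    and le: "\<And>x. norm (f x) \<le> norm (g x)" and "1 \<le> r"
  shows "Lp_norm r f \<le> Lp_norm r g"
proof (cases r)
  case (real t)
  with \<open>1 \<le> r\<close> have "1 \<le> t" by simp
  have "(LINT x|lborel. norm (f x) powr t) \<le> (LINT x|lborel. norm (g x) powr t)"
    using f g le \<open>1 \<le> t\<close> order_trans[OF le g(2)]
    by (intro integral_mono powr_mono2 integrable_powr_quadratic_decay[where C = C]) auto
  then show ?thesis
    unfolding real Lp_norm_finite using \<open>1 \<le> t\<close>
    by (intro powr_mono2 Bochner_Integration.integral_nonneg) auto
next
  case PInf
  \<comment> \<open>On nonnegative values \<open>real_of_ereal\<close> is monotone only if the
    larger one is finite; the decay of \<open>g\<close> provides this.\<close>
  from esssup_norm_le_continuous[OF g(1) quadratic_decay_bounded[OF g(2)]]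
  have "esssup lborel (\<lambda>x. ereal (norm (g x))) \<le> ereal C" .
  moreover have "esssup lborel (\<lambda>x. ereal (norm (f x))) \<le> esssup lborel (\<lambda>x. ereal (norm (g x)))"
    using borel_measurable_continuous_onI[OF f] le by (intro esssup_mono) auto
  moreover have "0 \<le> esssup lborel (\<lambda>x. ereal (norm (f x)))"
    using esssup_norm_ge_continuous[OF f, of 0] by (rule order_trans[rotated]) auto
  ultimately show ?thesis
    unfolding PInf Lp_norm_infinity by (intro real_of_ereal_positive_mono) auto
qed (use \<open>1 \<le> r\<close> in auto)

text \<open>A crude form of Minkowski's inequality, sufficient because only growth rates in
  \<open>s\<close> will matter. One factor 2 comes from bounding a sum by twice the maximum, the
  other from \<open>U powr r + V powr r \<le> 2 * (U + V) powr r\<close> and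
  \<open>2 \<le> 2 powr r\<close>.\<close>

lemma Lp_norm_le_add:
  assumes u: "u \<in> schwartz" and v: "v \<in> schwartz" and w: "w \<in> schwartz"
    and le: "\<And>x. norm (w x) \<le> norm (u x) + norm (v x)" and "1 \<le> r"
  shows "Lp_norm (ereal r) w \<le> 4 * (Lp_norm (ereal r) u + Lp_norm (ereal r) v)"
proof -
  have int: "integrable lborel (\<lambda>x. norm (f x) powr r)" if f: "f \<in> schwartz" for f
  proof -
    obtain C where "\<And>x. \<bar>x\<bar> ^ 0 * norm (f x) \<le> C * inverse (1 + x\<^sup>2)"
      using schwartz_decay[OF f] by blast
    then show ?thesis
      using f \<open>1 \<le> r\<close> by (intro integrable_powr_quadratic_decay[where C = C] schwartz_continuous) auto
  qed
  have pow: "Lp_norm (ereal r) f powr r = (LINT x|lborel. norm (f x) powr r)" for f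
    using \<open>1 \<le> r\<close> by (simp add: Lp_norm_finite powr_powr Bochner_Integration.integral_nonneg)
  define U V where "U = Lp_norm (ereal r) u" and "V = Lp_norm (ereal r) v"
  have nonneg: "0 \<le> Lp_norm (ereal r) f" for f
    by (simp add: Lp_norm_finite)
  have "Lp_norm (ereal r) w powr r \<le> (LINT x|lborel. 2 powr r * (norm (u x) powr r + norm (v x) powr r))"
    unfolding pow
  proof (rule integral_mono)
    show "norm (w x) powr r \<le> 2 powr r * (norm (u x) powr r + norm (v x) powr r)" for x
    proof -
      have "norm (w x) powr r \<le> (2 * max (norm (u x)) (norm (v x))) powr r"
        using le[of x] \<open>1 \<le> r\<close> by (intro powr_mono2) auto
      also have "\<dots> \<le> 2 powr r * (norm (u x) powr r + norm (v x) powr r)"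
        by (subst powr_mult) (auto simp: max_def)
      finally show ?thesis .
    qed
  qed (auto intro!: int u v w)
  also have "\<dots> = 2 powr r * (U powr r + V powr r)"
    by (simp add: U_def V_def pow int u v)
  also have "\<dots> \<le> 2 powr r * (2 powr r * (U + V) powr r)"
  proof (rule mult_left_mono)
    have "U powr r \<le> (U + V) powr r" "V powr r \<le> (U + V) powr r"
      using \<open>1 \<le> r\<close> nonneg by (auto intro!: powr_mono2 simp: U_def V_def)
    moreover have "2 * (U + V) powr r \<le> 2 powr r * (U + V) powr r"
      using \<open>1 \<le> r\<close> powr_mono[of 1 r 2] by (intro mult_right_mono) auto
    ultimately show "U powr r + V powr r \<le> 2 powr r * (U + V) powr r" by linarith
  qed auto
  also have "\<dots> = (4 * (U + V)) powr r"
  proof -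
    have "(4 * (U + V)) powr r = (2 * (2 * (U + V))) powr r" by simp
    then show ?thesis by (simp only: powr_mult)
  qed
  finally have le_powr: "Lp_norm (ereal r) w powr r \<le> (4 * (U + V)) powr r" .
  show ?thesis
  proof (rule ccontr)
    assume "\<not> ?thesis"
    then have "(4 * (U + V)) powr r < Lp_norm (ereal r) w powr r"
      using \<open>1 \<le> r\<close> nonneg by (intro powr_less_mono2) (auto simp: U_def V_def)
    with le_powr show False by simp
  qed
qed

text \<open>For finite exponents this is the Gaussian integral; for \<infinity> the supremum
  \<open>c\<close> is attained at 0. As \<open>real_of_ereal (1 / \<infinity>)\<close> is 0, one
  formula covers both, with \<open>k\<close> depending on \<open>r\<close> alone.\<close>

lemma Lp_norm_gaussian_profile_scaling:
  assumes "1 \<le> r"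
  obtains k where "0 < k" and
    "\<And>f c a. \<lbrakk>continuous_on UNIV f; 0 < c; 0 < a; \<And>x. norm (f x) = c * exp (- pi * a * x\<^sup>2)\<rbrakk>
      \<Longrightarrow> Lp_norm r f = c * k * a powr (- real_of_ereal (1 / r) / 2)"
proof (cases r)
  case (real t)
  with assms have "1 \<le> t" by simp
  show thesis
  proof (rule that)
    show "0 < t powr (- 1 / (2 * t))" using \<open>1 \<le> t\<close> by simp
    fix f :: "real \<Rightarrow> complex" and c a :: real
    assume *: "0 < c" "0 < a" "\<And>x. norm (f x) = c * exp (- pi * a * x\<^sup>2)"
    have "(LINT x|lborel. norm (f x) powr t) = (LINT x|lborel. c powr t * exp (- pi * (t * a) * x\<^sup>2))"
      using * by (simp add: powr_mult exp_powr_real mult_ac)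
    also have "\<dots> = c powr t * (t * a) powr (- 1 / 2)"
      using integral_gaussian[of "t * a"] * \<open>1 \<le> t\<close> by simp
    finally have "Lp_norm r f = (c powr t * (t * a) powr (- 1 / 2)) powr (1 / t)"
      by (simp add: real Lp_norm_finite)
    also have "\<dots> = c * t powr (- 1 / (2 * t)) * a powr (- 1 / (2 * t))"
      using * \<open>1 \<le> t\<close> by (simp add: powr_mult powr_powr)
    finally show "Lp_norm r f = c * t powr (- 1 / (2 * t)) * a powr (- real_of_ereal (1 / r) / 2)"
      using \<open>1 \<le> t\<close> by (simp add: real one_ereal_def mult.commute[of t 2])
  qed
next
  case PInf
  show thesis
  proof (rule that[of 1])
    fix f :: "real \<Rightarrow> complex" and c a :: real
    assume *: "continuous_on UNIV f" "0 < c" "0 < a" "\<And>x. norm (f x) = c * exp (- pi * a * x\<^sup>2)"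
    have "Lp_norm \<infinity> f = norm (f 0)"
      using * by (intro Lp_norm_infinity_attained) auto
    then show "Lp_norm r f = c * 1 * a powr (- real_of_ereal (1 / r) / 2)"
      using * by (simp add: PInf)
  qed simp
qed (use assms in auto)

text \<open>The case \<open>c = a = 1\<close> identifies the scaling constant. Only the modulus of
  \<open>f\<close> enters, so chirps and their transforms are covered too.\<close>

lemma Lp_norm_gaussian_profile:
  assumes "1 \<le> r" and f: "continuous_on UNIV f" "0 < c" "0 < a" "\<And>x. norm (f x) = c * exp (- pi * a * x\<^sup>2)"
  shows "Lp_norm r f = c * Lp_norm r (gaussian 1) * a powr (- real_of_ereal (1 / r) / 2)"
proof -
  obtain k where k: "\<And>f c a. \<lbrakk>continuous_on UNIV f; 0 < c; 0 < a; \<And>x. norm (f x) = c * exp (- pi * a * x\<^sup>2)\<rbrakk>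
      \<Longrightarrow> Lp_norm r f = c * k * a powr (- real_of_ereal (1 / r) / 2)"
    using Lp_norm_gaussian_profile_scaling[OF \<open>1 \<le> r\<close>] by blast
  have "Lp_norm r (gaussian 1) = 1 * k * 1 powr (- real_of_ereal (1 / r) / 2)"
    by (rule k) (auto simp: norm_gaussian intro: gaussian_continuous)
  then show ?thesis
    using k[OF f] by simp
qed

section \<open>Chirps\<close>

text \<open>The unknown constant \<open>fourier (gaussian z) 0\<close> cancels in the quotient.\<close>

lemma F_pq_chirp:
  assumes "1 \<le> p" "1 \<le> q"
  shows "F_pq p q (gaussian (Complex 1 b)) =
    (Lp_norm q (gaussian 1) / Lp_norm p (gaussian 1))\<^sup>2 *
    (1 / (1 + b\<^sup>2)) powr ((real_of_ereal (1 / p) - real_of_ereal (1 / q)) / 2)"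
proof -
  define kp kq where "kp = Lp_norm p (gaussian 1)" and "kq = Lp_norm q (gaussian 1)"
  define sp sq where "sp = real_of_ereal (1 / p)" and "sq = real_of_ereal (1 / q)"
  note kp = Lp_norm_gaussian_profile[OF \<open>1 \<le> p\<close>, folded kp_def sp_def]
  note kq = Lp_norm_gaussian_profile[OF \<open>1 \<le> q\<close>, folded kq_def sq_def]
  define z where "z = Complex 1 b"
  define A where "A = 1 / (1 + b\<^sup>2)"
  define N where "N = norm (fourier (gaussian z) 0)"
  have "0 < 1 + b\<^sup>2"
    by (rule add_pos_nonneg) auto
  then have A: "0 < A" "Re (1 / z) = A"
    by (simp_all add: A_def z_def Re_divide power2_eq_square)
  have "Re z = 1"
    by (simp add: z_def)
  then have g: "gaussian z \<in> schwartz"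
    by (intro gaussian_schwartz) simp
  \<comment> \<open>The chirp has the modulus of the real Gaussian, so its own norms do not depend
    on \<open>b\<close>; only its transform is spread out, with parameter \<open>A\<close>.\<close>
  have norm_g: "norm (gaussian z x) = 1 * exp (- pi * 1 * x\<^sup>2)" for x
    using \<open>Re z = 1\<close> by (simp add: norm_gaussian)
  have norm_G: "norm (fourier (gaussian z) x) = N * exp (- pi * A * x\<^sup>2)" for x
    using fourier_gaussian_shape[of z x] \<open>Re z = 1\<close> A(2) by (simp add: norm_mult norm_gaussian N_def)
  \<comment> \<open>If the transform vanished at 0, its Gaussian shape would make it vanish
    everywhere, against injectivity.\<close>
  have "N \<noteq> 0"
  proof
    assume "N = 0"
    then have "gaussian z 0 = 0"
      using norm_G by (intro fourier_eq_0_imp_eq_0[OF g]) simp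
    then show False by simp
  qed
  then have "0 < N"
    by (simp add: N_def)
  have "Lp_norm p (gaussian z) = kp" "Lp_norm q (gaussian z) = kq"
    using kp[of "gaussian z" 1 1] kq[of "gaussian z" 1 1] norm_g schwartz_continuous[OF g] by simp_all
  moreover have "Lp_norm p (fourier (gaussian z)) = N * kp * A powr (- sp / 2)"
      "Lp_norm q (fourier (gaussian z)) = N * kq * A powr (- sq / 2)"
    using kp[of "fourier (gaussian z)" N A] kq[of "fourier (gaussian z)" N A] norm_G fourier_continuous[OF g]
      \<open>0 < N\<close> A(1) by simp_all
  ultimately have "F_pq p q (gaussian z) = (kq / kp)\<^sup>2 * (A powr (- sq / 2) / A powr (- sp / 2))"
    using \<open>0 < N\<close> by (simp add: F_pq_def power2_eq_square)
  also have "A powr (- sq / 2) / A powr (- sp / 2) = A powr ((sp - sq) / 2)"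
    by (simp add: powr_diff[symmetric] diff_divide_distrib)
  finally show ?thesis
    by (simp add: z_def A_def kp_def kq_def sp_def sq_def)
qed

section \<open>Self-dual sums of two Gaussians\<close>

text \<open>The weights are chosen so that the two summands are Fourier transforms of each other:
  transforming the Gaussian with parameter \<open>s ^ 4\<close> produces the factor
  \<open>1 / s\<^sup>2\<close>, which turns the weight \<open>s\<close> into
  \<open>1 / s\<close>.\<close>

definition selfdual :: "real \<Rightarrow> real \<Rightarrow> complex" where
  "selfdual s x = of_real s * gaussian (of_real (s ^ 4)) x + of_real (1 / s) * gaussian (of_real (1 / s ^ 4)) x"

lemma selfdual_of_real:
  "selfdual s x = of_real (s * exp (- pi * s ^ 4 * x\<^sup>2) + 1 / s * exp (- pi * (1 / s ^ 4) * x\<^sup>2))"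
  by (simp only: selfdual_def gaussian_of_real of_real_add of_real_mult)

lemma norm_selfdual:
  assumes "0 < s"
  shows "norm (selfdual s x) = s * exp (- pi * s ^ 4 * x\<^sup>2) + 1 / s * exp (- pi * (1 / s ^ 4) * x\<^sup>2)"
  unfolding selfdual_of_real norm_of_real using assms by (intro abs_of_nonneg) simp

lemma cmult_gaussian_schwartz: "0 < Re z \<Longrightarrow> (\<lambda>x. c * gaussian z x) \<in> schwartz"
  using poly_gaussian_schwartz[of z "[:c:]"] by simp

lemma selfdual_schwartz:
  assumes "0 < s"
  shows "selfdual s \<in> schwartz"
  unfolding selfdual_def[abs_def] using assms by (intro schwartz_add cmult_gaussian_schwartz) auto

lemma fourier_add:
  assumes "integrable lborel f" "integrable lborel g"
  shows "fourier (\<lambda>x. f x + g x) \<xi> = fourier f \<xi> + fourier g \<xi>"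
  unfolding fourier_def distrib_right
  by (intro Bochner_Integration.integral_add integrable_fourier_integrand assms)

lemma power4_powr:
  fixes s :: real
  assumes "0 < s"
  shows "(s ^ 4) powr e = s powr (4 * e)" "(1 / s ^ 4) powr e = s powr (- (4 * e))"
proof -
  show "(s ^ 4) powr e = s powr (4 * e)"
    using powr_powr[of s 4 e] assms by simp
  have "1 / s ^ 4 = s powr (- 4)"
    using assms by (simp add: powr_minus_divide)
  then show "(1 / s ^ 4) powr e = s powr (- (4 * e))"
    by (simp only: powr_powr minus_mult_left)
qed

lemma fourier_selfdual:
  assumes "0 < s"
  shows "fourier (selfdual s) = selfdual s"
proof
  fix \<xi>
  have powr: "(s ^ 4) powr (-1/2) = 1 / s\<^sup>2" "(1 / s ^ 4) powr (-1/2) = s\<^sup>2"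
    using assms by (simp_all add: power4_powr powr_minus_divide)
  have "fourier (selfdual s) \<xi> =
      of_real s * (of_real ((s ^ 4) powr (-1/2)) * gaussian (of_real (1 / s ^ 4)) \<xi>) +
      of_real (1 / s) * (of_real ((1 / s ^ 4) powr (-1/2)) * gaussian (of_real (1 / (1 / s ^ 4))) \<xi>)"
    unfolding selfdual_def[abs_def] using assms
    by (subst fourier_add)
      (auto intro!: schwartz_integrable cmult_gaussian_schwartz simp: fourier_cmult fourier_gaussian_of_real simp del: of_real_power of_real_divide)
  then show "fourier (selfdual s) \<xi> = selfdual s \<xi>"
    unfolding powr selfdual_def using assms by (simp add: power2_eq_square)
qed

lemma F_pq_selfdual: "0 < s \<Longrightarrow> F_pq p q (selfdual s) = (Lp_norm q (selfdual s) / Lp_norm p (selfdual s))\<^sup>2"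
  by (simp add: F_pq_def fourier_selfdual power2_eq_square)

lemma Lp_norm_infinity_selfdual:
  assumes "0 < s"
  shows "Lp_norm \<infinity> (selfdual s) = s + 1 / s"
proof -
  have "norm (selfdual s x) \<le> norm (selfdual s 0)" for x
    unfolding norm_selfdual[OF assms] using assms by (intro add_mono mult_left_mono) auto
  from Lp_norm_infinity_attained[OF schwartz_continuous[OF selfdual_schwartz[OF assms]] this]
  show ?thesis
    by (simp add: norm_selfdual[OF assms])
qed

text \<open>Dominated convergence for finite exponents, an explicit formula for \<infinity>. The
  dominating \<open>W\<close> combines, for each summand separately, the largest weight and the
  widest profile that occur for \<open>s\<close> in \<open>{1..S}\<close>.\<close>

lemma continuous_on_Lp_norm_selfdual:
  assumes "1 \<le> r"
  shows "continuous_on {1..S} (\<lambda>s. Lp_norm r (selfdual s))"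
proof (cases r)
  case (real t)
  with assms have "1 \<le> t" by simp
  define W where "W x = of_real S * gaussian 1 x + gaussian (of_real (1 / S ^ 4)) x" for x
  have norm_le_W: "norm (selfdual s x) \<le> norm (W x)" if "s \<in> {1..S}" for s x
  proof -
    have s: "1 \<le> s" "s \<le> S" "1 \<le> s ^ 4" "s ^ 4 \<le> S ^ 4"
      using that by (auto intro: power_mono one_le_power)
    have "1 * x\<^sup>2 \<le> s ^ 4 * x\<^sup>2"
      using s by (intro mult_right_mono) auto
    then have "s * exp (- pi * s ^ 4 * x\<^sup>2) \<le> S * exp (- pi * 1 * x\<^sup>2)"
      using s by (intro mult_mono) auto
    moreover have "1 / s * exp (- pi * (1 / s ^ 4) * x\<^sup>2) \<le> 1 * exp (- pi * (1 / S ^ 4) * x\<^sup>2)"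
      using s by (intro mult_mono) (auto intro!: mult_right_mono divide_left_mono)
    ultimately have "norm (selfdual s x) \<le> S * exp (- pi * 1 * x\<^sup>2) + exp (- pi * (1 / S ^ 4) * x\<^sup>2)"
      using s by (subst norm_selfdual) auto
    also have "\<dots> = Re (W x)"
      unfolding W_def gaussian_of_real using gaussian_of_real[of 1 x] by simp
    also have "\<dots> \<le> norm (W x)"
      by (rule complex_Re_le_cmod)
    finally show ?thesis .
  qed
  show ?thesis
  proof (cases "1 \<le> S")
    case False
    then show ?thesis by simp
  next
    case True
    have "(\<lambda>x. of_real S * gaussian 1 x + 1 * gaussian (of_real (1 / S ^ 4)) x) \<in> schwartz"
      using True by (intro schwartz_add cmult_gaussian_schwartz) auto
    then have W: "W \<in> schwartz"
      by (simp add: W_def[abs_def])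
    obtain C where C: "\<And>x. \<bar>x\<bar> ^ 0 * norm (W x) \<le> C * inverse (1 + x\<^sup>2)"
      using schwartz_decay[OF W] by blast
    have "((\<lambda>s. LINT x|lborel. norm (selfdual s x) powr t) \<longlongrightarrow> (LINT x|lborel. norm (selfdual a x) powr t)) (at a within {1..S})"
      if a: "a \<in> {1..S}" for a
    proof (rule integral_dominated_convergence_at_within[where w = "\<lambda>x. norm (W x) powr t"])
      show "integrable lborel (\<lambda>x. norm (W x) powr t)"
        using C \<open>1 \<le> t\<close> by (intro integrable_powr_quadratic_decay[where C = C] schwartz_continuous W) auto
      have "(\<lambda>x. norm (selfdual s x) powr t) \<in> borel_measurable lborel" if "s \<in> {1..S}" for s
        using borel_measurable_continuous_onI[OF schwartz_continuous[OF selfdual_schwartz[of s]]] that by simp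
      then show "(\<lambda>x. norm (selfdual a x) powr t) \<in> borel_measurable lborel"
          "\<And>s. s \<in> {1..S} - {a} \<Longrightarrow> (\<lambda>x. norm (selfdual s x) powr t) \<in> borel_measurable lborel"
        using a by auto
      show "norm (norm (selfdual s x) powr t) \<le> norm (W x) powr t" if "s \<in> {1..S} - {a}" for s x
        using norm_le_W[of s x] that \<open>1 \<le> t\<close> by (simp add: powr_mono2)
      have "continuous_on {1..S} (\<lambda>s. norm (selfdual s x) powr t)" for x
        unfolding selfdual_of_real using \<open>1 \<le> t\<close> by (intro continuous_on_powr' continuous_intros) auto
      then show "((\<lambda>s. norm (selfdual s x) powr t) \<longlongrightarrow> norm (selfdual a x) powr t) (at a within {1..S})" for x
        using a unfolding continuous_on_def by blast
    qed
    then have "continuous_on {1..S} (\<lambda>s. LINT x|lborel. norm (selfdual s x) powr t)"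
      by (simp add: continuous_on_def)
    then show ?thesis
      unfolding real Lp_norm_finite using \<open>1 \<le> t\<close>
      by (intro continuous_on_powr' continuous_intros) (auto intro: Bochner_Integration.integral_nonneg)
  qed
next
  case PInf
  have "continuous_on {1..S} (\<lambda>s. s + 1 / s)"
    by (intro continuous_intros) auto
  then show ?thesis
    unfolding PInf by (rule continuous_on_eq) (simp add: Lp_norm_infinity_selfdual)
qed (use assms in auto)

text \<open>The two powers of \<open>s\<close> are the norms of the tall and the wide summand,
  computed by scaling, up to the norm of \<open>gaussian 1\<close>.\<close>

lemma Lp_norm_selfdual_le:
  assumes "1 \<le> r" "0 < s"
  shows "Lp_norm (ereal r) (selfdual s) \<le>
    4 * Lp_norm (ereal r) (gaussian 1) * (s powr (1 - 2 * (1 / r)) + s powr (2 * (1 / r) - 1))"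
proof -
  define k \<sigma> where "k = Lp_norm (ereal r) (gaussian 1)" and "\<sigma> = 1 / r"
  have "real_of_ereal (1 / ereal r) = \<sigma>"
    using \<open>1 \<le> r\<close> by (simp add: \<sigma>_def one_ereal_def)
  with Lp_norm_gaussian_profile[of "ereal r"] \<open>1 \<le> r\<close>
  have k: "Lp_norm (ereal r) f = c * k * a powr (- \<sigma> / 2)"
    if "continuous_on UNIV f" "0 < c" "0 < a" "\<And>x. norm (f x) = c * exp (- pi * a * x\<^sup>2)" for f c a
    using that by (simp add: k_def)
  define u where "u x = of_real s * gaussian (of_real (s ^ 4)) x" for x
  define v where "v x = of_real (1 / s) * gaussian (of_real (1 / s ^ 4)) x" for x
  have uv: "u \<in> schwartz" "v \<in> schwartz"
    unfolding u_def[abs_def] v_def[abs_def]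
    by (rule cmult_gaussian_schwartz, use \<open>0 < s\<close> in simp)+
  have "Lp_norm (ereal r) (selfdual s) \<le> 4 * (Lp_norm (ereal r) u + Lp_norm (ereal r) v)"
    using \<open>1 \<le> r\<close> uv selfdual_schwartz[OF \<open>0 < s\<close>]
    by (intro Lp_norm_le_add) (auto simp: selfdual_def u_def v_def intro: norm_triangle_ineq)
  also have "Lp_norm (ereal r) u = s * k * (s ^ 4) powr (- \<sigma> / 2)"
    using \<open>0 < s\<close> by (intro k schwartz_continuous uv) (auto simp: u_def gaussian_of_real norm_mult simp del: of_real_power of_real_mult of_real_divide)
  also have "Lp_norm (ereal r) v = 1 / s * k * (1 / s ^ 4) powr (- \<sigma> / 2)"
    using \<open>0 < s\<close> by (intro k schwartz_continuous uv) (auto simp: v_def gaussian_of_real norm_mult norm_divide simp del: of_real_power of_real_mult of_real_divide)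
  also have "4 * (s * k * (s ^ 4) powr (- \<sigma> / 2) + 1 / s * k * (1 / s ^ 4) powr (- \<sigma> / 2)) =
      4 * k * (s powr (1 - 2 * \<sigma>) + s powr (2 * \<sigma> - 1))"
  proof -
    have 1: "s * (s ^ 4) powr (- \<sigma> / 2) = s powr (1 - 2 * \<sigma>)"
      using \<open>0 < s\<close> by (simp add: power4_powr powr_mult_base)
    have 2: "1 / s * (1 / s ^ 4) powr (- \<sigma> / 2) = s powr (2 * \<sigma> - 1)"
      using \<open>0 < s\<close> by (simp add: power4_powr powr_diff)
    show ?thesis
      unfolding 1[symmetric] 2[symmetric] by (simp only: algebra_simps)
  qed
  finally show ?thesis
    unfolding k_def \<sigma>_def .
qed

text \<open>Both summands are nonnegative, so the norm does not increase when the wide one is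
  dropped; the tall one is evaluated by scaling.\<close>

lemma Lp_norm_selfdual_ge:
  assumes "1 \<le> r" "0 < s"
  shows "Lp_norm r (gaussian 1) * s powr (1 - 2 * real_of_ereal (1 / r)) \<le> Lp_norm r (selfdual s)"
proof -
  define k \<sigma> where "k = Lp_norm r (gaussian 1)" and "\<sigma> = real_of_ereal (1 / r)"
  note k = Lp_norm_gaussian_profile[OF \<open>1 \<le> r\<close>, folded k_def \<sigma>_def]
  define u where "u x = of_real s * gaussian (of_real (s ^ 4)) x" for x
  have u: "u \<in> schwartz"
    unfolding u_def[abs_def] using \<open>0 < s\<close> by (auto intro!: cmult_gaussian_schwartz)
  have norm_u: "norm (u x) = s * exp (- pi * s ^ 4 * x\<^sup>2)" for x
    using \<open>0 < s\<close> by (simp add: u_def gaussian_of_real norm_mult del: of_real_power of_real_mult)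
  have "s powr (1 - 2 * \<sigma>) = s * (s ^ 4) powr (- \<sigma> / 2)"
    using \<open>0 < s\<close> by (simp add: power4_powr powr_mult_base)
  then have "k * s powr (1 - 2 * \<sigma>) = s * k * (s ^ 4) powr (- \<sigma> / 2)"
    by (simp only: mult_ac)
  also have "s * k * (s ^ 4) powr (- \<sigma> / 2) = Lp_norm r u"
    using \<open>0 < s\<close> norm_u by (intro k[symmetric] schwartz_continuous u) auto
  also obtain C where "\<And>x. \<bar>x\<bar> ^ 0 * norm (selfdual s x) \<le> C * inverse (1 + x\<^sup>2)"
    using schwartz_decay[OF selfdual_schwartz[OF \<open>0 < s\<close>]] by blast
  then have "Lp_norm r u \<le> Lp_norm r (selfdual s)"
    using \<open>0 < s\<close> \<open>1 \<le> r\<close>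
    by (intro Lp_norm_mono[where C = C] schwartz_continuous u selfdual_schwartz) (auto simp: norm_u norm_selfdual)
  finally show ?thesis
    unfolding k_def \<sigma>_def .
qed

section \<open>The image of the quotient\<close>

theorem theorem4p6:
  fixes p q :: ereal
  assumes "1 < p" and "p < q" and "q \<le> \<infinity>" and "1 / p + 1 / q < 1"
  shows "F_pq p q ` (schwartz - {(\<lambda>x. 0)}) = {0<..}"
proof
  have "1 \<le> p" "1 \<le> q"
    using assms by auto
  then show "F_pq p q ` (schwartz - {(\<lambda>x. 0)}) \<subseteq> {0<..}"
    using F_pq_pos by auto
  define sp sq where "sp = real_of_ereal (1 / p)" and "sq = real_of_ereal (1 / q)"
  \<comment> \<open>\<open>p < q\<close> forces \<open>p\<close> to be finite, whereas
    \<open>q\<close> may be \<infinity>, in which case \<open>sq\<close> is 0.\<close>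
  obtain P where P: "p = ereal P" "1 < P"
    using assms(1,2) by (cases p) auto
  have sp: "sp = 1 / P"
    using P by (simp add: sp_def one_ereal_def)
  have "sq < sp \<and> sp + sq < 1"
  proof (cases q)
    case (real Q)
    then have "sq = 1 / Q" "P < Q"
      using assms(2) P by (auto simp: sq_def one_ereal_def)
    moreover have "1 / P + 1 / Q < 1"
      using assms(4) P real \<open>P < Q\<close> by (auto simp: one_ereal_def)
    ultimately show ?thesis
      using P by (auto simp: sp frac_less2)
  next
    case PInf
    then show ?thesis
      using P by (simp add: sq_def sp)
  qed (use assms in auto)
  then have "sq < sp" "sp + sq < 1" by auto
  define kp kq where "kp = Lp_norm p (gaussian 1)" and "kq = Lp_norm q (gaussian 1)"
  have gaussian_1: "gaussian 1 \<in> schwartz" "gaussian 1 \<noteq> (\<lambda>x. 0)"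
    by (auto intro!: gaussian_schwartz dest: fun_cong[of _ _ 0])
  have kp_pos: "0 < kp" and kq_pos: "0 < kq"
    unfolding kp_def kq_def by (intro Lp_norm_schwartz_pos gaussian_1 \<open>1 \<le> p\<close> \<open>1 \<le> q\<close>)+
  define K where "K = (kq / kp)\<^sup>2"
  have "0 < K"
    using kp_pos kq_pos by (simp add: K_def)
  show "{0<..} \<subseteq> F_pq p q ` (schwartz - {(\<lambda>x. 0)})"
  proof
    fix y :: real assume "y \<in> {0<..}"
    then have "0 < y" by simp
    show "y \<in> F_pq p q ` (schwartz - {(\<lambda>x. 0)})"
    proof (cases "y \<le> K")
      case True
      \<comment> \<open>\<open>A\<close> solves \<open>K * A powr ((sp - sq) / 2) = y\<close>. The
        case \<open>y \<le> K\<close> gives \<open>A \<le> 1\<close>, so that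
        \<open>1 / (1 + b\<^sup>2) = A\<close> has a real solution \<open>b\<close>.\<close>
      define A where "A = (y / K) powr (2 / (sp - sq))"
      have "0 < A" "A \<le> 1"
        using \<open>0 < y\<close> \<open>0 < K\<close> True \<open>sq < sp\<close> by (auto simp: A_def intro: powr_le1)
      define b where "b = sqrt (1 / A - 1)"
      have b: "1 / (1 + b\<^sup>2) = A"
        using \<open>0 < A\<close> \<open>A \<le> 1\<close> by (simp add: b_def)
      have powr_A: "A powr ((sp - sq) / 2) = y / K"
      proof -
        have exponent: "2 / (sp - sq) * ((sp - sq) / 2) = 1"
          using \<open>sq < sp\<close> by simp
        show ?thesis
          unfolding A_def powr_powr exponent using \<open>0 < y\<close> \<open>0 < K\<close> by simp
      qed
      have "F_pq p q (gaussian (Complex 1 b)) = K * (1 / (1 + b\<^sup>2)) powr ((sp - sq) / 2)"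
        unfolding K_def kp_def kq_def sp_def sq_def by (rule F_pq_chirp[OF \<open>1 \<le> p\<close> \<open>1 \<le> q\<close>])
      then have "F_pq p q (gaussian (Complex 1 b)) = y"
        unfolding b powr_A using \<open>0 < K\<close> by simp
      moreover have "gaussian (Complex 1 b) \<in> schwartz" "gaussian (Complex 1 b) \<noteq> (\<lambda>x. 0)"
        by (auto intro!: gaussian_schwartz dest: fun_cong[of _ _ 0])
      ultimately show ?thesis by blast
    next
      case False
      have selfdual_nonzero: "selfdual s \<noteq> (\<lambda>x. 0)" if "0 < s" for s
      proof
        assume "selfdual s = (\<lambda>x. 0)"
        then show False
          using norm_selfdual[OF that, of 0] that by (simp add: add_pos_pos less_imp_neq)
      qed
      \<comment> \<open>On the self-dual family \<open>F_pq\<close> is the square of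
        \<open>R\<close>, so the value to be reached by \<open>R\<close> is
        \<open>sqrt y\<close>.\<close>
      define R where "R s = Lp_norm q (selfdual s) / Lp_norm p (selfdual s)" for s
      \<comment> \<open>At \<open>s = 1\<close> the two summands coincide and
        \<open>selfdual 1\<close> is twice the standard Gaussian.\<close>
      have R1: "R 1 = kq / kp"
      proof -
        have "norm (selfdual 1 x) = 2 * exp (- pi * 1 * x\<^sup>2)" for x
          by (simp add: norm_selfdual)
        then have "Lp_norm p (selfdual 1) = 2 * kp" "Lp_norm q (selfdual 1) = 2 * kq"
          using Lp_norm_gaussian_profile[of p "selfdual 1" 2 1] Lp_norm_gaussian_profile[of q "selfdual 1" 2 1]
            schwartz_continuous[OF selfdual_schwartz[of 1]] \<open>1 \<le> p\<close> \<open>1 \<le> q\<close> by (simp_all add: kp_def kq_def)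
        then show ?thesis by (simp add: R_def)
      qed
      \<comment> \<open>\<open>\<alpha>\<close> and \<open>\<beta>\<close> are the exponents
        \<open>1 - 2 * sp\<close> and \<open>2 * sp - 1\<close> of the upper bound in
        \<open>p\<close>, each minus the exponent \<open>1 - 2 * sq\<close> of the lower bound in
        \<open>q\<close>. Their negativity is exactly \<open>sq < sp\<close> and
        \<open>sp + sq < 1\<close>.\<close>
      define \<alpha> where "\<alpha> = 2 * sq - 2 * sp"
      define \<beta> where "\<beta> = 2 * sp + 2 * sq - 2"
      have neg: "\<alpha> < 0" "\<beta> < 0"
        using \<open>sq < sp\<close> \<open>sp + sq < 1\<close> by (auto simp: \<alpha>_def \<beta>_def)
      have R_ge: "kq / (4 * kp) / (s powr \<alpha> + s powr \<beta>) \<le> R s" if "0 < s" for s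
      proof -
        have "4 * kp * (s powr (1 - 2 * sp) + s powr (2 * sp - 1)) =
            4 * kp * (s powr (1 - 2 * sq) * (s powr \<alpha> + s powr \<beta>))"
          unfolding \<alpha>_def \<beta>_def distrib_left powr_add[symmetric] by simp
        moreover have "Lp_norm p (selfdual s) \<le> 4 * kp * (s powr (1 - 2 * sp) + s powr (2 * sp - 1))"
          unfolding kp_def sp P(1) using P(2) that by (intro Lp_norm_selfdual_le) auto
        ultimately have "Lp_norm p (selfdual s) \<le> 4 * kp * (s powr (1 - 2 * sq) * (s powr \<alpha> + s powr \<beta>))" by (simp only:)
        moreover have "0 < Lp_norm p (selfdual s)"
          using \<open>1 \<le> p\<close> that by (intro Lp_norm_schwartz_pos selfdual_schwartz selfdual_nonzero)
        moreover have ge: "kq * s powr (1 - 2 * sq) \<le> Lp_norm q (selfdual s)"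
          unfolding kq_def sq_def using \<open>1 \<le> q\<close> that by (rule Lp_norm_selfdual_ge)
        moreover have "0 \<le> Lp_norm q (selfdual s)"
          using kq_pos by (intro order_trans[OF _ ge]) simp
        ultimately have "kq * s powr (1 - 2 * sq) / (4 * kp * (s powr (1 - 2 * sq) * (s powr \<alpha> + s powr \<beta>))) \<le> R s"
          unfolding R_def by (intro frac_le)
        then show ?thesis
          using that by (simp add: mult_ac)
      qed
      \<comment> \<open>The denominator in \<open>R_ge\<close> tends to 0, so for some
        \<open>S \<ge> 1\<close> the lower bound for \<open>R S\<close> exceeds
        \<open>sqrt y\<close>; this is the right end for the intermediate value theorem.\<close>
      have "((\<lambda>s. s powr \<alpha> + s powr \<beta>) \<longlongrightarrow> 0 + 0) at_top"
        using neg by (intro tendsto_add tendsto_neg_powr filterlim_ident)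
      then have "\<forall>\<^sub>F s in at_top. s powr \<alpha> + s powr \<beta> < kq / (4 * kp) / sqrt y"
        using kp_pos kq_pos \<open>0 < y\<close> by (intro order_tendstoD(2)) auto
      then have "\<forall>\<^sub>F s in at_top. s powr \<alpha> + s powr \<beta> < kq / (4 * kp) / sqrt y \<and> 1 \<le> s"
        by (intro eventually_conj eventually_ge_at_top)
      then obtain S where S: "S powr \<alpha> + S powr \<beta> < kq / (4 * kp) / sqrt y" "1 \<le> S"
        by (auto simp: eventually_at_top_linorder)
      have "0 < S powr \<alpha> + S powr \<beta>"
        using \<open>1 \<le> S\<close> by (intro add_pos_pos) auto
      then have "sqrt y \<le> kq / (4 * kp) / (S powr \<alpha> + S powr \<beta>)"
        using S(1) \<open>0 < y\<close> by (simp only: pos_le_divide_eq pos_less_divide_eq real_sqrt_gt_zero mult.commute less_imp_le)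
      also have "\<dots> \<le> R S"
        using S(2) by (intro R_ge) simp
      finally have "sqrt y \<le> R S" .
      \<comment> \<open>In this case \<open>y\<close> is larger than \<open>K\<close>, the square of
        \<open>R 1\<close>.\<close>
      moreover have "R 1 \<le> sqrt y"
        using False kp_pos kq_pos \<open>0 < y\<close> unfolding R1 K_def by (intro real_le_rsqrt) simp
      moreover have "continuous_on {1..S} R"
        unfolding R_def
      proof (intro continuous_on_divide continuous_on_Lp_norm_selfdual \<open>1 \<le> p\<close> \<open>1 \<le> q\<close> ballI)
        fix s assume "s \<in> {1..S}"
        then have "0 < Lp_norm p (selfdual s)"
          using \<open>1 \<le> p\<close> by (intro Lp_norm_schwartz_pos selfdual_schwartz selfdual_nonzero) auto
        then show "Lp_norm p (selfdual s) \<noteq> 0" by simp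
      qed
      ultimately obtain s where s: "1 \<le> s" "R s = sqrt y"
        using IVT'[of R 1 "sqrt y" S] \<open>1 \<le> S\<close> by blast
      then have "F_pq p q (selfdual s) = y"
        using \<open>0 < y\<close> by (simp add: F_pq_selfdual R_def[symmetric])
      moreover have "selfdual s \<in> schwartz" "selfdual s \<noteq> (\<lambda>x. 0)"
        using s(1) by (auto intro!: selfdual_schwartz selfdual_nonzero)
      ultimately show ?thesis by blast
    qed
  qed
qed

end
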